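(* Let $X\in 2^\omega$ be proper and non-computable. Then the following are equivalent: (i) $X$ is complex; (ii) $X\notin\mathrm{NCR}_{\mathrm{comp}}$; (iii) $X$ is not semigeneric; (iv) $X$ is avoidable; (v) $X$ is hyperavoidable. In particular, no conditionally avoidable sequence is proper.
   Context: All measures are Borel probability measures on Cantor space $2^\omega$. A measure $\mu$ is computable if $\sigma\mapsto\mu(\{X:\sigma\prec X\})$ is a computable real-valued function on finite binary strings, and continuous if $\mu(\{X\})=0$ for all $X$. A $\mu$-Martin-Löf test is a uniformly $\Sigma^0_1$ sequence $(\mathcal U_i)_{i\in\omega}$ with $\mu(\mathcal U_i)\le 2^{-i}$; $X$ is $\mu$-Martin-Löf random if $X\notin\bigcap_i\mathcal U_i$ for every such test. $X$ is proper if it is $\mu$-Martin-Löf random for some computable measure $\mu$. $\mathrm{NCR}_{\mathrm{comp}}$ is the set of sequences that are not Martin-Löf random with respect to any computable, continuous measure. $\mathrm K$ is prefix-free Kolmogorov complexity; an order is a non-decreasing unbounded function $f:\omega\to\omega$ with $f(0)=0$; $X$ is complex if there is a computable order $f$ with $\mathrm K(X\upharpoonright n)\ge f(n)$ for all $n$, where $X\upharpoonright n$ is the initial segment of length $n$. A non-computable $X\in 2^\omega$ is semigeneric if every $\Pi^0_1$ class containing $X$ also contains a computable sequence. $X$ is avoidable if there is a partial computable function $p$ such that for every computable set $M$ and every index $e$ for $M$ (i.e. for its characteristic function), $p(e)$ is defined and $X\upharpoonright p(e)\ne M\upharpoonright p(e)$. $X$ is hyperavoidable if it is avoidable via such a $p$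 that is total. $X$ is conditionally avoidable if it is avoidable but not hyperavoidable. *)

theory Defs
  imports "HOL-Probability.Probability" "HOL-Library.Nat_Bijection" "HOL-Library.Sublist"
begin

section \<open>Partial computable functions and their indices\<close>

text \<open>
  Unary partial recursive functions, with \<^const>\<open>prod_encode\<close> as pairing function.
  Several arguments are passed as nested pairs.
\<close>

datatype prog =
    Zero | Succ | Proj1 | Proj2
  | Pairing prog prog
  | Comp prog prog
  | Prec prog prog
  | Mu prog

text \<open>
  Writing \<open>\<langle>a, b\<rangle>\<close> for \<open>prod_encode (a, b)\<close>: \<open>h = Prec f g\<close> is primitive recursion,
  \<open>h\<langle>a, 0\<rangle> = f a\<close> and \<open>h\<langle>a, n + 1\<rangle> = g\<langle>a, \<langle>n, h\<langle>a, n\<rangle>\<rangle>\<rangle>\<close>. \<open>Mu f\<close> is unbounded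
  minimisation: on input \<open>a\<close> it returns the least \<open>n\<close> with \<open>f\<langle>a, n\<rangle> = 0\<close>, provided that
  \<open>f\<langle>a, m\<rangle>\<close> is defined for all \<open>m < n\<close>. \<open>None\<close> stands for divergence.
\<close>

primrec run :: "prog \<Rightarrow> nat \<Rightarrow> nat option" where
  "run Zero = (\<lambda>x. Some 0)"
| "run Succ = (\<lambda>x. Some (Suc x))"
| "run Proj1 = (\<lambda>x. Some (fst (prod_decode x)))"
| "run Proj2 = (\<lambda>x. Some (snd (prod_decode x)))"
| "run (Pairing f g) =
     (\<lambda>x. Option.bind (run f x) (\<lambda>a. Option.bind (run g x) (\<lambda>b. Some (prod_encode (a, b)))))"
| "run (Comp f g) = (\<lambda>x. Option.bind (run g x) (run f))"
| "run (Prec f g) =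
     (\<lambda>x. case prod_decode x of (a, n) \<Rightarrow>
        rec_nat (run f a)
          (\<lambda>m r. Option.bind r (\<lambda>v. run g (prod_encode (a, prod_encode (m, v))))) n)"
| "run (Mu f) =
     (\<lambda>a. if \<exists>n. run f (prod_encode (a, n)) = Some 0 \<and>
                 (\<forall>m<n. run f (prod_encode (a, m)) \<noteq> None)
          then Some (LEAST n. run f (prod_encode (a, n)) = Some 0)
          else None)"

definition partial_computable :: "(nat \<Rightarrow> nat option) \<Rightarrow> bool" where
  "partial_computable f \<longleftrightarrow> (\<exists>p. run p = f)"

definition computable_fun :: "(nat \<Rightarrow> nat) \<Rightarrow> bool" where
  "computable_fun f \<longleftrightarrow> partial_computable (\<lambda>x. Some (f x))"

definition ce_set :: "nat set \<Rightarrow> bool" where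
  "ce_set A \<longleftrightarrow> (\<exists>f. partial_computable f \<and> A = dom f)"

primrec goedel :: "prog \<Rightarrow> nat" where
  "goedel Zero = prod_encode (0, 0)"
| "goedel Succ = prod_encode (1, 0)"
| "goedel Proj1 = prod_encode (2, 0)"
| "goedel Proj2 = prod_encode (3, 0)"
| "goedel (Pairing f g) = prod_encode (4, prod_encode (goedel f, goedel g))"
| "goedel (Comp f g) = prod_encode (5, prod_encode (goedel f, goedel g))"
| "goedel (Prec f g) = prod_encode (6, prod_encode (goedel f, goedel g))"
| "goedel (Mu f) = prod_encode (7, goedel f)"

lemma goedel_inject: "goedel p = goedel q \<Longrightarrow> p = q"
proof (induction p arbitrary: q)
  case Zero then show ?case by (cases q) auto
next
  case Succ then show ?case by (cases q) auto
next
  case Proj1 then show ?case by (cases q) auto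
next
  case Proj2 then show ?case by (cases q) auto
next
  case (Pairing f g) then show ?case by (cases q) auto
next
  case (Comp f g) then show ?case by (cases q) auto
next
  case (Prec f g) then show ?case by (cases q) auto
next
  case (Mu f) then show ?case by (cases q) auto
qed

text \<open>The standard numbering; numbers that code no program index the empty function.\<close>

definition phi :: "nat \<Rightarrow> nat \<Rightarrow> nat option" where
  "phi e = (if e \<in> range goedel then run (inv goedel e) else Map.empty)"

lemma phi_goedel [simp]: "phi (goedel p) = run p"
proof -
  have "inj goedel" by (rule injI) (rule goedel_inject)
  then show ?thesis by (simp add: phi_def)
qed


section \<open>Strings and Cantor space\<close>

text \<open>
  Cantor space is \<^typ>\<open>nat \<Rightarrow> bool\<close> with the product topology of the library; subsets of
  the natural numbers are identified with their characteristic functions.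
\<close>

type_synonym cantor = "nat \<Rightarrow> bool"

definition str_code :: "bool list \<Rightarrow> nat" where
  "str_code \<sigma> = list_encode (map of_bool \<sigma>)"

lemma str_code_inject [simp]: "str_code \<sigma> = str_code \<tau> \<longleftrightarrow> \<sigma> = \<tau>"
proof -
  have "inj (of_bool :: bool \<Rightarrow> nat)" by (rule injI) (simp add: of_bool_def split: if_splits)
  then show ?thesis by (simp add: str_code_def list_encode_eq inj_map_eq_map)
qed

definition init_seg :: "cantor \<Rightarrow> nat \<Rightarrow> bool list" where
  "init_seg X n = map X [0..<n]"

definition cylinder :: "bool list \<Rightarrow> cantor set" where
  "cylinder \<sigma> = {X. init_seg X (length \<sigma>) = \<sigma>}"

lemma open_cylinder: "open (cylinder \<sigma>)"
proof -
  have "cylinder \<sigma> = Pi\<^sub>E UNIV (\<lambda>i. if i < length \<sigma> then {\<sigma> ! i} else UNIV)"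
    unfolding cylinder_def init_seg_def list_eq_iff_nth_eq PiE_UNIV_domain Pi_def by auto
  moreover have "open \<dots>"
  proof (rule open_PiE)
    show "open (if i < length \<sigma> then {\<sigma> ! i} else UNIV)" for i
      by (rule Topological_Spaces.open_discrete)
    have "{i. (if i < length \<sigma> then {\<sigma> ! i} else UNIV) \<noteq> UNIV} \<subseteq> {..<length \<sigma>}"
      by auto
    then show "finite {i. (if i < length \<sigma> then {\<sigma> ! i} else UNIV) \<noteq> UNIV}"
      by (rule finite_subset) simp
  qed
  ultimately show ?thesis by simp
qed

definition index_of :: "nat \<Rightarrow> cantor \<Rightarrow> bool" where
  "index_of e M \<longleftrightarrow> (\<forall>n. phi e n = Some (of_bool (M n)))"

definition computable_seq :: "cantor \<Rightarrow> bool" where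
  "computable_seq X \<longleftrightarrow> computable_fun (\<lambda>n. of_bool (X n))"

definition uniformly_sigma1 :: "(nat \<Rightarrow> cantor set) \<Rightarrow> bool" where
  "uniformly_sigma1 U \<longleftrightarrow>
     (\<exists>W. ce_set W \<and> (\<forall>i. U i = \<Union>{cylinder \<sigma> |\<sigma>. prod_encode (i, str_code \<sigma>) \<in> W}))"

definition sigma1_class :: "cantor set \<Rightarrow> bool" where
  "sigma1_class U \<longleftrightarrow> (\<exists>W. ce_set W \<and> U = \<Union>{cylinder \<sigma> |\<sigma>. str_code \<sigma> \<in> W})"

definition pi1_class :: "cantor set \<Rightarrow> bool" where
  "pi1_class C \<longleftrightarrow> sigma1_class (- C)"


section \<open>Computable measures and Martin-Loef randomness\<close>

text \<open>
  Computability of a real-valued function on strings: from \<open>\<sigma>\<close> and \<open>n\<close> one can compute a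
  rational, given as \<open>(a - b) / (d + 1)\<close>, within \<open>2\<^sup>-\<^sup>n\<close> of the value at \<open>\<sigma>\<close>.
\<close>

definition computable_real_fun :: "(bool list \<Rightarrow> real) \<Rightarrow> bool" where
  "computable_real_fun f \<longleftrightarrow>
     (\<exists>a b d. computable_fun a \<and> computable_fun b \<and> computable_fun d \<and>
       (\<forall>\<sigma> n. let k = prod_encode (str_code \<sigma>, n) in
          \<bar>f \<sigma> - (real (a k) - real (b k)) / real (d k + 1)\<bar> \<le> 1 / 2 ^ n))"

definition cantor_measure :: "cantor measure \<Rightarrow> bool" where
  "cantor_measure \<mu> \<longleftrightarrow> prob_space \<mu> \<and> sets \<mu> = sets borel"

definition computable_measure :: "cantor measure \<Rightarrow> bool" where
  "computable_measure \<mu> \<longleftrightarrow>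
     cantor_measure \<mu> \<and> computable_real_fun (\<lambda>\<sigma>. measure \<mu> (cylinder \<sigma>))"

definition continuous_measure :: "cantor measure \<Rightarrow> bool" where
  "continuous_measure \<mu> \<longleftrightarrow> (\<forall>X. measure \<mu> {X} = 0)"

definition martin_loef_test :: "cantor measure \<Rightarrow> (nat \<Rightarrow> cantor set) \<Rightarrow> bool" where
  "martin_loef_test \<mu> U \<longleftrightarrow> uniformly_sigma1 U \<and> (\<forall>i. measure \<mu> (U i) \<le> 1 / 2 ^ i)"

definition martin_loef_random :: "cantor measure \<Rightarrow> cantor \<Rightarrow> bool" where
  "martin_loef_random \<mu> X \<longleftrightarrow> (\<forall>U. martin_loef_test \<mu> U \<longrightarrow> X \<notin> (\<Inter>i. U i))"

definition proper :: "cantor \<Rightarrow> bool" where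
  "proper X \<longleftrightarrow> (\<exists>\<mu>. computable_measure \<mu> \<and> martin_loef_random \<mu> X)"

definition NCR_comp :: "cantor set" where
  "NCR_comp = {X. \<not> (\<exists>\<mu>. computable_measure \<mu> \<and> continuous_measure \<mu> \<and> martin_loef_random \<mu> X)}"


section \<open>Prefix-free complexity\<close>

definition prefix_free_machine :: "(bool list \<Rightarrow> bool list option) \<Rightarrow> bool" where
  "prefix_free_machine M \<longleftrightarrow>
     (\<exists>p. \<forall>\<tau>. run p (str_code \<tau>) = map_option str_code (M \<tau>)) \<and>
     (\<forall>\<tau>\<in>dom M. \<forall>\<tau>'\<in>dom M. prefix \<tau> \<tau>' \<longrightarrow> \<tau> = \<tau>')"

text \<open>
  Universality in the sense of optimality: \<open>U\<close> has descriptions as short as those of any other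
  prefix-free machine, up to an additive constant depending on the machine only.
\<close>

definition universal_prefix_free_machine :: "(bool list \<Rightarrow> bool list option) \<Rightarrow> bool" where
  "universal_prefix_free_machine U \<longleftrightarrow>
     prefix_free_machine U \<and>
     (\<forall>M. prefix_free_machine M \<longrightarrow>
        (\<exists>c. \<forall>\<tau> \<sigma>. M \<tau> = Some \<sigma> \<longrightarrow>
           (\<exists>\<tau>'. U \<tau>' = Some \<sigma> \<and> length \<tau>' \<le> length \<tau> + c)))"

text \<open>
  A universal \<open>U\<close> is onto, so the minimum is over a nonempty set. The usual fixed choice of \<open>U\<close>
  is a parameter here; it changes \<open>K\<close> by at most an additive constant.
\<close>

definition K :: "(bool list \<Rightarrow> bool list option) \<Rightarrow> bool list \<Rightarrow> nat" where
  "K U \<sigma> = (LEAST n. \<exists>\<tau>. length \<tau> = n \<and> U \<tau> = Some \<sigma>)"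

definition order_fun :: "(nat \<Rightarrow> nat) \<Rightarrow> bool" where
  "order_fun f \<longleftrightarrow> mono f \<and> (\<forall>b. \<exists>n. b < f n) \<and> f 0 = 0"

definition complex_seq :: "(bool list \<Rightarrow> bool list option) \<Rightarrow> cantor \<Rightarrow> bool" where
  "complex_seq U X \<longleftrightarrow>
     (\<exists>f. computable_fun f \<and> order_fun f \<and> (\<forall>n. K U (init_seg X n) \<ge> f n))"


section \<open>Semigenericity and avoidability\<close>

definition semigeneric :: "cantor \<Rightarrow> bool" where
  "semigeneric X \<longleftrightarrow>
     \<not> computable_seq X \<and> (\<forall>C. pi1_class C \<and> X \<in> C \<longrightarrow> (\<exists>Y\<in>C. computable_seq Y))"

definition avoidable_via :: "cantor \<Rightarrow> (nat \<Rightarrow> nat option) \<Rightarrow> bool" where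
  "avoidable_via X p \<longleftrightarrow>
     partial_computable p \<and>
     (\<forall>M e. computable_seq M \<and> index_of e M \<longrightarrow>
        (\<exists>n. p e = Some n \<and> init_seg X n \<noteq> init_seg M n))"

definition avoidable :: "cantor \<Rightarrow> bool" where
  "avoidable X \<longleftrightarrow> (\<exists>p. avoidable_via X p)"

definition hyperavoidable :: "cantor \<Rightarrow> bool" where
  "hyperavoidable X \<longleftrightarrow> (\<exists>p. avoidable_via X p \<and> (\<forall>e. p e \<noteq> None))"

definition conditionally_avoidable :: "cantor \<Rightarrow> bool" where
  "conditionally_avoidable X \<longleftrightarrow> avoidable X \<and> \<not> hyperavoidable X"

end

(*
For a proper non-computable X the properties are linked in a cycle.

If X is avoidable via p, the recursion theorem turns each index e into an index e' of a function
that follows phi_e until p(e') has converged and is zero afterwards. As soon as phi_e is defined on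
a long enough initial segment, phi_e' is total, so X differs from that segment. The cylinders
of these segments form a Sigma^0_1 class V that contains all computable sequences but not X.

Let X be random for the computable measure mu, and let V be such a class. Replacing the bits of a
sequence by fair coin flips from the moment at which it is seen to enter V gives a computable
measure nu. It is continuous, since every atom of mu is computable and hence in V. Strings
not yet enumerated into V keep their measure, so X is still random.

A continuous computable mu has a computable modulus g with mu[sigma] <= 2^-e whenever
|sigma| >= g(e). If X is random for mu, the test U_i = union over e of [phi_e restricted to
g(e+i+1)] gives hyperavoidability. The analogous test with phi_e replaced by the e-th output of the
universal machine gives a computable lower bound for K.

If X is complex with K(X|n) >= f(n), let n_e be least with f(n_e) > 2e+1. The prefix-free machine
1^e 0 |-> phi_e|n_e shows that X|n_e = phi_e|n_e is impossible for all large e.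
*)
theory Submission
  imports Defs
begin

section \<open>Computable functions\<close>

text \<open>Two semidecidable events have to be waited for, and both waits are tied to a length so
  that they become decidable. The switch to coin flips takes place once a search bounded by the
  length of the string read so far has confirmed entry into V; this may delay the switch but never
  cancels it, and it makes \<nu> computable. Likewise the function with index e' writes zeros from
  the first position m such that p(e') has converged by stage m to a value at most m. Bounding the
  value as well keeps the zeros away from the positions below p(e'). If X extended the segment, then
  X with these zeros would be a computable sequence with index e' that agrees with X below p(e'),
  against avoidability. Programs are run through a relation that may also hold for numbers coding no
  program. For an arbitrary e, the proof relies on two facts: the relation is single-valued and
  contains the graph of phi_e.\<close>

abbreviation pr1 :: "nat \<Rightarrow> nat" where "pr1 z \<equiv> fst (prod_decode z)"
abbreviation pr2 :: "nat \<Rightarrow> nat" where "pr2 z \<equiv> snd (prod_decode z)"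

definition decidable :: "(nat \<Rightarrow> bool) \<Rightarrow> bool" where
  "decidable P \<longleftrightarrow> computable_fun (\<lambda>x. of_bool (P x))"

text \<open>Each closure rule speaks of functions of one coded argument, so that a compound term
  decomposes along its syntax. A variable bound inside the term joins the argument in a pair and
  reappears as \<open>pr2 z\<close>.\<close>

named_theorems comp_intros

section \<open>Closure under composition, pairing and primitive recursion\<close>

lemma computable_funI: "run p = (\<lambda>x. Some (f x)) \<Longrightarrow> computable_fun f"
  by (auto simp: computable_fun_def partial_computable_def)

lemma computable_funE:
  assumes "computable_fun f" obtains p where "run p = (\<lambda>x. Some (f x))"
  using assms by (auto simp: computable_fun_def partial_computable_def)

lemma computable_fun_comp:
  assumes "computable_fun f" "computable_fun g"
  shows "computable_fun (\<lambda>x. f (g x))"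
proof -
  obtain p q where "run p = (\<lambda>x. Some (f x))" "run q = (\<lambda>x. Some (g x))"
    using assms by (elim computable_funE)
  then show ?thesis by (intro computable_funI[of "Comp p q"]) simp
qed

lemma decidable_comp: "decidable P \<Longrightarrow> computable_fun g \<Longrightarrow> decidable (\<lambda>x. P (g x))"
  unfolding decidable_def by (rule computable_fun_comp)

lemma computable_fun_id [comp_intros]: "computable_fun (\<lambda>x. x)"
  by (rule computable_funI[of "Pairing Proj1 Proj2"]) simp

lemma computable_fun_pair [comp_intros]:
  assumes "computable_fun f" "computable_fun g"
  shows "computable_fun (\<lambda>x. prod_encode (f x, g x))"
proof -
  obtain p q where "run p = (\<lambda>x. Some (f x))" "run q = (\<lambda>x. Some (g x))"
    using assms by (elim computable_funE)
  then show ?thesis by (intro computable_funI[of "Pairing p q"]) simp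
qed

lemma computable_fun_comp2:
  assumes "computable_fun (\<lambda>z. f (pr1 z) (pr2 z))" "computable_fun g" "computable_fun h"
  shows "computable_fun (\<lambda>x. f (g x) (h x))"
  using computable_fun_comp[OF assms(1) computable_fun_pair[OF assms(2,3)]] by simp

lemma decidable_comp2:
  assumes "decidable (\<lambda>z. P (pr1 z) (pr2 z))" "computable_fun g" "computable_fun h"
  shows "decidable (\<lambda>x. P (g x) (h x))"
  using decidable_comp[OF assms(1) computable_fun_pair[OF assms(2,3)]] by simp

lemma computable_fun_Suc [comp_intros]:
  "computable_fun f \<Longrightarrow> computable_fun (\<lambda>x. Suc (f x))"
  by (rule computable_fun_comp[of Suc]) (rule computable_funI[of Succ], simp)

lemma computable_fun_pr1 [comp_intros]:
  "computable_fun f \<Longrightarrow> computable_fun (\<lambda>x. pr1 (f x))"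
  by (rule computable_fun_comp[of pr1]) (rule computable_funI[of Proj1], simp)

lemma computable_fun_pr2 [comp_intros]:
  "computable_fun f \<Longrightarrow> computable_fun (\<lambda>x. pr2 (f x))"
  by (rule computable_fun_comp[of pr2]) (rule computable_funI[of Proj2], simp)

primrec const_prog :: "nat \<Rightarrow> prog" where
  "const_prog 0 = Zero"
| "const_prog (Suc n) = Comp Succ (const_prog n)"

lemma run_const_prog [simp]: "run (const_prog n) = (\<lambda>x. Some n)"
  by (induction n) auto

lemma computable_fun_const [comp_intros]: "computable_fun (\<lambda>x. c)"
  by (rule computable_funI[of "const_prog c"]) simp

lemma computable_fun_rec [comp_intros]:
  assumes "computable_fun n" "computable_fun f"
    "computable_fun (\<lambda>z. g (pr1 z) (pr1 (pr2 z)) (pr2 (pr2 z)))"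
  shows "computable_fun (\<lambda>x. rec_nat (f x) (g x) (n x))"
proof -
  obtain p q where p: "run p = (\<lambda>x. Some (f x))"
    and q: "run q = (\<lambda>z. Some (g (pr1 z) (pr1 (pr2 z)) (pr2 (pr2 z))))"
    using assms(2,3) by (elim computable_funE)
  have "rec_nat (run p a) (\<lambda>m r. Option.bind r (\<lambda>v. run q (prod_encode (a, prod_encode (m, v))))) k
      = Some (rec_nat (f a) (g a) k)" for a k
    by (induction k) (simp_all add: p q)
  then have "computable_fun (\<lambda>z. rec_nat (f (pr1 z)) (g (pr1 z)) (pr2 z))"
    by (intro computable_funI[of "Prec p q"]) (simp add: case_prod_beta)
  from computable_fun_comp[OF this computable_fun_pair[OF computable_fun_id assms(1)]]
  show ?thesis by simp
qed


section \<open>Arithmetic, case distinction and bounded sums by recursion\<close>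

lemma computable_fun_add [comp_intros]:
  assumes "computable_fun f" "computable_fun g"
  shows "computable_fun (\<lambda>x. f x + g x)"
proof -
  have "m + k = rec_nat m (\<lambda>_ r. Suc r) k" for m k :: nat
    by (induction k) auto
  then show ?thesis by (simp only:) (intro comp_intros assms)
qed

lemma computable_fun_diff [comp_intros]:
  assumes "computable_fun f" "computable_fun g"
  shows "computable_fun (\<lambda>x. f x - g x)"
proof -
  have pred: "k - 1 = rec_nat 0 (\<lambda>m _. m) k" for k :: nat
    by (cases k) auto
  have "m - k = rec_nat m (\<lambda>_ r. r - 1) k" for m k :: nat
    by (induction k) auto
  then show ?thesis by (simp only: pred) (intro comp_intros assms)
qed

lemma computable_fun_mult [comp_intros]:
  assumes "computable_fun f" "computable_fun g"
  shows "computable_fun (\<lambda>x. f x * g x)"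
proof -
  have "m * k = rec_nat 0 (\<lambda>_ r. r + m) k" for m k :: nat
    by (induction k) auto
  then show ?thesis by (simp only:) (intro comp_intros assms computable_fun_comp[OF assms(1)])
qed

lemma computable_fun_power [comp_intros]:
  assumes "computable_fun f" "computable_fun g"
  shows "computable_fun (\<lambda>x. f x ^ g x)"
proof -
  have "m ^ k = rec_nat 1 (\<lambda>_ r. r * m) k" for m k :: nat
    by (induction k) auto
  then show ?thesis by (simp only:) (intro comp_intros assms computable_fun_comp[OF assms(1)])
qed

lemma computable_fun_of_bool [comp_intros]:
  "decidable P \<Longrightarrow> computable_fun (\<lambda>x. of_bool (P x))"
  by (simp add: decidable_def)

lemma computable_fun_if [comp_intros]:
  assumes "decidable P" "computable_fun f" "computable_fun g"
  shows "computable_fun (\<lambda>x. if P x then f x else g x)"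
proof -
  have "(if b then k else m) = rec_nat m (\<lambda>_ _. k) (of_bool b)" for b and m k :: nat
    by auto
  then show ?thesis by (simp only:) (intro comp_intros assms computable_fun_comp[OF assms(2)])
qed

lemma computable_fun_sum [comp_intros]:
  assumes "computable_fun n" "computable_fun (\<lambda>z. f (pr1 z) (pr2 z))"
  shows "computable_fun (\<lambda>x. \<Sum>m<n x. f x m)"
proof -
  have "(\<Sum>m<n. h m) = rec_nat 0 (\<lambda>m r. r + h m) n" for h :: "nat \<Rightarrow> nat" and n
    by (induction n) auto
  then show ?thesis
    by (simp only:) (intro comp_intros assms(1) computable_fun_comp2[OF assms(2)])
qed

section \<open>Decidable relations, bounded quantifiers and unbounded search\<close>

lemma decidable_le [comp_intros]:
  assumes "computable_fun f" "computable_fun g"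
  shows "decidable (\<lambda>x. f x \<le> g x)"
proof -
  have "of_bool (m \<le> k) = 1 - (m - k)" for m k :: nat
    by auto
  then show ?thesis unfolding decidable_def by (simp only:) (intro comp_intros assms)
qed

lemma decidable_less [comp_intros]:
  "computable_fun f \<Longrightarrow> computable_fun g \<Longrightarrow> decidable (\<lambda>x. f x < g x)"
  unfolding less_eq_Suc_le by (intro comp_intros)

lemma decidable_not [comp_intros]:
  assumes "decidable P"
  shows "decidable (\<lambda>x. \<not> P x)"
proof -
  have "of_bool (\<not> b) = 1 - (of_bool b :: nat)" for b
    by auto
  then show ?thesis unfolding decidable_def by (simp only:) (intro comp_intros assms)
qed

lemma decidable_conj [comp_intros]:
  assumes "decidable P" "decidable Q"
  shows "decidable (\<lambda>x. P x \<and> Q x)"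
  unfolding decidable_def of_bool_conj by (intro comp_intros assms)

lemma decidable_disj [comp_intros]:
  assumes "decidable P" "decidable Q"
  shows "decidable (\<lambda>x. P x \<or> Q x)"
proof -
  have "P x \<or> Q x \<longleftrightarrow> \<not> (\<not> P x \<and> \<not> Q x)" for x by blast
  then show ?thesis by (simp only:) (intro comp_intros assms)
qed

lemma decidable_imp [comp_intros]:
  assumes "decidable P" "decidable Q"
  shows "decidable (\<lambda>x. P x \<longrightarrow> Q x)"
  unfolding imp_conv_disj by (intro comp_intros assms)

lemma decidable_eq [comp_intros]:
  fixes f g :: "nat \<Rightarrow> nat"
  assumes "computable_fun f" "computable_fun g"
  shows "decidable (\<lambda>x. f x = g x)"
  unfolding eq_iff by (intro comp_intros assms)

lemma decidable_all_less [comp_intros]: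
  assumes "computable_fun n" "decidable (\<lambda>z. P (pr1 z) (pr2 z))"
  shows "decidable (\<lambda>x. \<forall>m<n x. P x m)"
proof -
  have "(\<forall>m<n. Q m) \<longleftrightarrow> (\<Sum>m<n. of_bool (\<not> Q m)) = (0::nat)" for Q and n :: nat
    by auto
  then show ?thesis by (simp only:) (intro comp_intros assms(1) decidable_comp2[OF assms(2)])
qed

lemma decidable_ex_less [comp_intros]:
  assumes "computable_fun n" "decidable (\<lambda>z. P (pr1 z) (pr2 z))"
  shows "decidable (\<lambda>x. \<exists>m<n x. P x m)"
proof -
  have "(\<exists>m<n. Q m) \<longleftrightarrow> \<not> (\<forall>m<n. \<not> Q m)" for Q and n :: nat
    by auto
  then show ?thesis by (simp only:) (intro comp_intros assms(1) decidable_comp2[OF assms(2)])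
qed

text \<open>\<open>Mu\<close> looks for a zero, so it is applied to the characteristic function of
  the negation. That function is total, which settles the definedness condition in
  \<open>Mu\<close>.\<close>

lemma minimization:
  assumes "decidable (\<lambda>z. P (pr1 z) (pr2 z))"
  shows "partial_computable (\<lambda>x. if \<exists>n. P x n then Some (LEAST n. P x n) else None)"
proof -
  have "computable_fun (\<lambda>z. of_bool (\<not> P (pr1 z) (pr2 z)))"
    by (intro comp_intros assms)
  then obtain p where "run p = (\<lambda>z. Some (of_bool (\<not> P (pr1 z) (pr2 z))))"
    by (elim computable_funE)
  then have "run (Mu p) = (\<lambda>x. if \<exists>n. P x n then Some (LEAST n. P x n) else None)"
    by (intro ext) simp
  then show ?thesis unfolding partial_computable_def by blast
qed

lemma computable_fun_Least [comp_intros]: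
  assumes "decidable (\<lambda>z. P (pr1 z) (pr2 z))" "\<And>x. \<exists>n. P x n"
  shows "computable_fun (\<lambda>x. LEAST n. P x n)"
  unfolding computable_fun_def using minimization[OF assms(1)] assms(2) by simp

lemma partial_computable_bind:
  assumes "partial_computable f" "partial_computable g"
  shows "partial_computable (\<lambda>x. Option.bind (g x) f)"
proof -
  obtain p q where "run p = f" "run q = g"
    using assms by (auto simp: partial_computable_def)
  then have "run (Comp p q) = (\<lambda>x. Option.bind (g x) f)" by simp
  then show ?thesis unfolding partial_computable_def by blast
qed

section \<open>Coded lists\<close>

text \<open>The empty list has code 0 and a nonempty one the successor of the coded pair of head and
  tail; hence the predecessor before each projection. On the code 0 truncated subtraction leaves 0,
  which decodes to the pair of zeros, so 0 is the default for both head and tail.\<close>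

definition hd_code :: "nat \<Rightarrow> nat" where "hd_code z = pr1 (z - 1)"
definition tl_code :: "nat \<Rightarrow> nat" where "tl_code z = pr2 (z - 1)"
definition drop_code :: "nat \<Rightarrow> nat \<Rightarrow> nat" where "drop_code i z = rec_nat z (\<lambda>_. tl_code) i"
definition nth_code :: "nat \<Rightarrow> nat \<Rightarrow> nat" where "nth_code z i = hd_code (drop_code i z)"
definition length_code :: "nat \<Rightarrow> nat" where "length_code z = length (list_decode z)"

lemma tl_code_0 [simp]: "tl_code 0 = 0"
  by (simp add: tl_code_def prod_decode_def prod_decode_aux.simps)

lemma hd_code_0 [simp]: "hd_code 0 = 0"
  by (simp add: hd_code_def prod_decode_def prod_decode_aux.simps)

lemma list_decode_tl_code: "list_decode (tl_code z) = tl (list_decode z)"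
  by (cases z) (simp, simp add: tl_code_def case_prod_beta)

lemma list_decode_drop_code: "list_decode (drop_code i z) = drop i (list_decode z)"
  by (induction i) (auto simp: drop_code_def list_decode_tl_code drop_Suc tl_drop)

lemma hd_code_eq: "list_decode z \<noteq> [] \<Longrightarrow> hd_code z = hd (list_decode z)"
  by (cases z) (auto simp: hd_code_def case_prod_beta)

lemma list_decode_eq_Nil_iff: "list_decode z = [] \<longleftrightarrow> z = 0"
  by (cases z) (auto simp: case_prod_beta)

lemma nth_code_eq: "i < length_code z \<Longrightarrow> nth_code z i = list_decode z ! i"
  unfolding nth_code_def length_code_def
  by (subst hd_code_eq) (auto simp: list_decode_drop_code hd_drop_conv_nth)

text \<open>The default 0 matters for the stages of the evaluation: an entry there counts only if it
  is 1, so triples outside the table count as not derived.\<close>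

lemma nth_code_beyond: "i \<ge> length_code z \<Longrightarrow> nth_code z i = 0"
proof -
  assume "i \<ge> length_code z"
  then have "list_decode (drop_code i z) = []"
    by (simp add: list_decode_drop_code length_code_def)
  then show ?thesis by (simp add: nth_code_def list_decode_eq_Nil_iff)
qed

text \<open>Turns the length into an unbounded search over computable data, the form in which its
  computability is shown.\<close>

lemma length_code_Least: "length_code z = (LEAST i. drop_code i z = 0)"
proof (rule Least_equality[symmetric])
  show "drop_code (length_code z) z = 0"
    using list_decode_drop_code[of "length_code z" z]
    by (simp add: length_code_def list_decode_eq_Nil_iff)
  show "length_code z \<le> i" if "drop_code i z = 0" for i
    using list_decode_drop_code[of i z] that by (simp add: length_code_def)
qed

lemma code_eqI:
  assumes "length_code y = length_code z" "\<And>i. i < length_code y \<Longrightarrow> nth_code y i = nth_code z i"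
  shows "y = z"
proof -
  have "list_decode y = list_decode z"
    using assms by (intro nth_equalityI) (auto simp: nth_code_eq[symmetric] length_code_def)
  then show ?thesis by (metis list_decode_inverse)
qed

lemma length_code_encode [simp]: "length_code (list_encode xs) = length xs"
  by (simp add: length_code_def)

lemma nth_code_encode: "i < length xs \<Longrightarrow> nth_code (list_encode xs) i = xs ! i"
  by (simp add: nth_code_eq)

lemma computable_fun_hd_code [comp_intros]:
  "computable_fun f \<Longrightarrow> computable_fun (\<lambda>x. hd_code (f x))"
  unfolding hd_code_def by (intro comp_intros)

lemma computable_fun_tl_code [comp_intros]:
  "computable_fun f \<Longrightarrow> computable_fun (\<lambda>x. tl_code (f x))"
  unfolding tl_code_def by (intro comp_intros)

lemma computable_fun_drop_code [comp_intros]: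
  "computable_fun i \<Longrightarrow> computable_fun f \<Longrightarrow> computable_fun (\<lambda>x. drop_code (i x) (f x))"
  unfolding drop_code_def by (intro comp_intros)

lemma computable_fun_nth_code [comp_intros]:
  "computable_fun f \<Longrightarrow> computable_fun i \<Longrightarrow> computable_fun (\<lambda>x. nth_code (f x) (i x))"
  unfolding nth_code_def by (intro comp_intros)

lemma computable_fun_length_code [comp_intros]:
  assumes "computable_fun f"
  shows "computable_fun (\<lambda>x. length_code (f x))"
proof -
  have "\<exists>i. drop_code i z = 0" for z
    by (rule exI[of _ "length_code z"]) (metis nth_code_def list_decode_drop_code length_code_def
        drop_all le_refl list_decode_eq_Nil_iff)
  then show ?thesis unfolding length_code_Least
    by (intro comp_intros computable_fun_comp[OF assms])
qed

lemma computable_fun_map_upt [comp_intros]: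
  assumes "computable_fun (\<lambda>z. f (pr1 z) (pr2 z))" "computable_fun n"
  shows "computable_fun (\<lambda>x. list_encode (map (f x) [0..<n x]))"
proof -
  \<comment> \<open>The code of a list grows by adding an entry in front, so the recursion runs
    through the suffixes, the last entry first.\<close>
  have "j \<le> n \<Longrightarrow> list_encode (map g [n - j..<n]) =
      rec_nat 0 (\<lambda>m r. Suc (prod_encode (g (n - Suc m), r))) j" for g and n j :: nat
  proof (induction j)
    case (Suc j)
    then have "[n - Suc j..<n] = (n - Suc j) # [n - j..<n]"
      by (subst upt_conv_Cons) (auto simp: Suc_diff_Suc)
    with Suc show ?case by simp
  qed simp
  from this[of n n for n] have *: "list_encode (map g [0..<n]) =
      rec_nat 0 (\<lambda>m r. Suc (prod_encode (g (n - Suc m), r))) n" for g and n :: nat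
    by simp
  show ?thesis unfolding *
    by (intro comp_intros assms(2) computable_fun_comp2[OF assms(1)] computable_fun_comp[OF assms(2)])
qed

definition take_code :: "nat \<Rightarrow> nat \<Rightarrow> nat" where
  "take_code k z = list_encode (map (nth_code z) [0..<min k (length_code z)])"

lemma take_code_eq: "take_code k z = list_encode (take k (list_decode z))"
  unfolding take_code_def
  by (intro arg_cong[of _ _ list_encode] nth_equalityI) (auto simp: nth_code_eq length_code_def)

lemma computable_fun_take_code [comp_intros]:
  assumes "computable_fun k" "computable_fun f"
  shows "computable_fun (\<lambda>x. take_code (k x) (f x))"
proof -
  show ?thesis unfolding take_code_def min_def
    by (intro comp_intros assms computable_fun_comp[OF assms(2)])
qed


section \<open>Semidecidable predicates\<close>

text \<open>The projection form of computable enumerability. Closure properties reduce to pairing or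
  bounding witnesses; \<open>ce_set_iff\<close> gives the link to domains of partial computable
  functions.\<close>

definition semidecidable :: "(nat \<Rightarrow> bool) \<Rightarrow> bool" where
  "semidecidable P \<longleftrightarrow>
     (\<exists>Q. decidable (\<lambda>z. Q (pr1 z) (pr2 z)) \<and> (\<forall>x. P x \<longleftrightarrow> (\<exists>s. Q x s)))"

named_theorems semi_intros

lemma decidable_imp_semidecidable:
  assumes "decidable P" shows "semidecidable P"
  unfolding semidecidable_def
  by (rule exI[of _ "\<lambda>x _. P x"]) (simp add: decidable_comp[OF assms] comp_intros)

lemma semidecidableI:
  "decidable (\<lambda>z. Q (pr1 z) (pr2 z)) \<Longrightarrow> (\<And>x. P x \<longleftrightarrow> (\<exists>s. Q x s)) \<Longrightarrow> semidecidable P"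
  unfolding semidecidable_def by blast

lemma semidecidableE:
  assumes "semidecidable P"
  obtains Q where "decidable (\<lambda>z. Q (pr1 z) (pr2 z))" "\<And>x. P x \<longleftrightarrow> (\<exists>s. Q x s)"
  using assms unfolding semidecidable_def by blast

lemma semidecidable_comp:
  assumes "semidecidable P" "computable_fun g"
  shows "semidecidable (\<lambda>x. P (g x))"
proof -
  obtain Q where Q: "decidable (\<lambda>z. Q (pr1 z) (pr2 z))" "\<And>x. P x \<longleftrightarrow> (\<exists>s. Q x s)"
    using assms(1) unfolding semidecidable_def by blast
  show ?thesis
    by (rule semidecidableI[of "\<lambda>x. Q (g x)"])
      (intro decidable_comp2[OF Q(1)] computable_fun_comp[OF assms(2)] comp_intros Q(2))+
qed

lemma semidecidable_ex [semi_intros]: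
  assumes "semidecidable (\<lambda>z. P (pr1 z) (pr2 z))"
  shows "semidecidable (\<lambda>x. \<exists>y. P x y)"
proof -
  obtain Q where Q: "decidable (\<lambda>z. Q (pr1 z) (pr2 z))"
      "\<And>x. P (pr1 x) (pr2 x) \<longleftrightarrow> (\<exists>s. Q x s)"
    using assms unfolding semidecidable_def by blast
  show ?thesis
  proof (rule semidecidableI[of "\<lambda>x s. Q (prod_encode (x, pr1 s)) (pr2 s)"])
    show "decidable (\<lambda>z. Q (prod_encode (pr1 z, pr1 (pr2 z))) (pr2 (pr2 z)))"
      by (intro comp_intros decidable_comp2[OF Q(1)])
    show "(\<exists>y. P x y) \<longleftrightarrow> (\<exists>s. Q (prod_encode (x, pr1 s)) (pr2 s))" for x
      using Q(2)[of "prod_encode (x, y)" for y] by simp (metis fst_conv prod_encode_inverse snd_conv)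
  qed
qed

lemma semidecidable_conj [semi_intros]:
  assumes "semidecidable P" "semidecidable P'"
  shows "semidecidable (\<lambda>x. P x \<and> P' x)"
proof -
  obtain Q where Q: "decidable (\<lambda>z. Q (pr1 z) (pr2 z))" "\<And>x. P x \<longleftrightarrow> (\<exists>s. Q x s)"
    using assms(1) unfolding semidecidable_def by blast
  obtain Q' where Q': "decidable (\<lambda>z. Q' (pr1 z) (pr2 z))" "\<And>x. P' x \<longleftrightarrow> (\<exists>s. Q' x s)"
    using assms(2) unfolding semidecidable_def by blast
  have "semidecidable (\<lambda>x. \<exists>s s'. Q x s \<and> Q' x s')"
    by (intro semi_intros decidable_imp_semidecidable comp_intros
        decidable_comp2[OF Q(1)] decidable_comp2[OF Q'(1)])
  then show ?thesis by (simp add: Q(2) Q'(2))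
qed

lemma semidecidable_disj [semi_intros]:
  assumes "semidecidable P" "semidecidable P'"
  shows "semidecidable (\<lambda>x. P x \<or> P' x)"
proof -
  obtain Q where Q: "decidable (\<lambda>z. Q (pr1 z) (pr2 z))" "\<And>x. P x \<longleftrightarrow> (\<exists>s. Q x s)"
    using assms(1) unfolding semidecidable_def by blast
  obtain Q' where Q': "decidable (\<lambda>z. Q' (pr1 z) (pr2 z))" "\<And>x. P' x \<longleftrightarrow> (\<exists>s. Q' x s)"
    using assms(2) unfolding semidecidable_def by blast
  have "semidecidable (\<lambda>x. \<exists>s s'. Q x s \<or> Q' x s')"
    by (intro semidecidable_ex decidable_imp_semidecidable comp_intros
        decidable_comp2[OF Q(1)] decidable_comp2[OF Q'(1)])
  then show ?thesis by (simp add: Q(2) Q'(2))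
qed

text \<open>The finitely many witnesses have a common strict bound s. Guessing s alone leaves only
  bounded quantifiers, and these stay decidable.\<close>

lemma semidecidable_all_less [semi_intros]:
  assumes "computable_fun n" "semidecidable (\<lambda>z. P (pr1 z) (pr2 z))"
  shows "semidecidable (\<lambda>x. \<forall>m<n x. P x m)"
proof -
  obtain Q where Q: "decidable (\<lambda>z. Q (pr1 z) (pr2 z))"
      "\<And>x. P (pr1 x) (pr2 x) \<longleftrightarrow> (\<exists>s. Q x s)"
    using assms(2) unfolding semidecidable_def by blast
  show ?thesis
  proof (rule semidecidableI[of "\<lambda>x s. \<forall>m<n x. \<exists>s'<s. Q (prod_encode (x, m)) s'"])
    show "decidable (\<lambda>z. \<forall>m<n (pr1 z). \<exists>s'<pr2 z. Q (prod_encode (pr1 z, m)) s')"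
      by (intro comp_intros decidable_comp2[OF Q(1)] computable_fun_comp[OF assms(1)])
    show "(\<forall>m<n x. P x m) \<longleftrightarrow> (\<exists>s. \<forall>m<n x. \<exists>s'<s. Q (prod_encode (x, m)) s')" for x
    proof
      assume "\<forall>m<n x. P x m"
      then have "\<forall>m<n x. \<exists>s. Q (prod_encode (x, m)) s"
        using Q(2)[of "prod_encode (x, m)" for m] by simp
      then obtain s where s: "\<forall>m<n x. Q (prod_encode (x, m)) (s m)" by metis
      have "s m < Suc (\<Sum>i<n x. s i)" if "m < n x" for m
        using that member_le_sum[of m "{..<n x}" s] by (simp add: le_imp_less_Suc)
      with s show "\<exists>s. \<forall>m<n x. \<exists>s'<s. Q (prod_encode (x, m)) s'" by blast
    next
      assume "\<exists>s. \<forall>m<n x. \<exists>s'<s. Q (prod_encode (x, m)) s'"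
      then show "\<forall>m<n x. P x m"
        using Q(2)[of "prod_encode (x, m)" for m] by auto
    qed
  qed
qed

text \<open>The search is for a value together with its witness, coded as one number. The function
  returns some related value, not a prescribed one; where a particular value is wanted, it is
  recovered from uniqueness of evaluation.\<close>

lemma semidecidable_uniformization:
  assumes "semidecidable (\<lambda>z. R (pr1 z) (pr2 z))"
  obtains f where "partial_computable f" "\<And>x y. f x = Some y \<Longrightarrow> R x y" "\<And>x y. R x y \<Longrightarrow> f x \<noteq> None"
proof -
  obtain Q where Q: "decidable (\<lambda>z. Q (pr1 z) (pr2 z))"
      "\<And>x. R (pr1 x) (pr2 x) \<longleftrightarrow> (\<exists>s. Q x s)"
    using assms unfolding semidecidable_def by blast
  define f0 where "f0 = (\<lambda>x. if \<exists>s. Q (prod_encode (x, pr1 s)) (pr2 s)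
    then Some (LEAST s. Q (prod_encode (x, pr1 s)) (pr2 s)) else None)"
  have "partial_computable f0" unfolding f0_def
    by (intro minimization comp_intros decidable_comp2[OF Q(1)])
  moreover have "partial_computable (\<lambda>s. Some (pr1 s))"
    by (fold computable_fun_def) (intro comp_intros)
  ultimately have 1: "partial_computable (\<lambda>x. Option.bind (f0 x) (\<lambda>s. Some (pr1 s)))"
    by (rule partial_computable_bind[rotated])
  show ?thesis
  proof (rule that[OF 1])
    fix x y assume "Option.bind (f0 x) (\<lambda>s. Some (pr1 s)) = Some y"
    then obtain s where s: "f0 x = Some s" "y = pr1 s"
      by (cases "f0 x") auto
    then have "Q (prod_encode (x, pr1 s)) (pr2 s)"
      unfolding f0_def by (auto split: if_splits intro: LeastI_ex)
    then show "R x y" using Q(2)[of "prod_encode (x, pr1 s)"] s by auto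
  next
    fix x y assume "R x y"
    then obtain s where "Q (prod_encode (x, y)) s"
      using Q(2)[of "prod_encode (x, y)"] by auto
    then have "\<exists>s. Q (prod_encode (x, pr1 s)) (pr2 s)"
      by (intro exI[of _ "prod_encode (y, s)"]) simp
    then show "Option.bind (f0 x) (\<lambda>s. Some (pr1 s)) \<noteq> None"
      by (simp add: f0_def)
  qed
qed

section \<open>A universal semidecidable evaluation predicate\<close>

text \<open>
  \<open>stage k\<close> codes the set of triples \<open>(e, x, y)\<close>, coded below \<open>k\<close>, for which
  \<open>\<phi>\<^sub>e(x) = y\<close> has a derivation of height at most \<open>k\<close>, as the list of values of its
  characteristic function. Subprograms that are not executed are not inspected, so \<open>evals e\<close>
  may be nonempty for an \<open>e\<close> that codes no program, although \<open>phi e\<close> is empty then.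
\<close>

definition in_stage :: "nat \<Rightarrow> nat \<Rightarrow> nat \<Rightarrow> nat \<Rightarrow> bool" where
  "in_stage c e x y \<longleftrightarrow> nth_code c (prod_encode (e, prod_encode (x, y))) = 1"

definition derivable :: "nat \<Rightarrow> nat \<Rightarrow> nat \<Rightarrow> nat \<Rightarrow> nat \<Rightarrow> bool" where
  "derivable c b e x y \<longleftrightarrow>
     e = prod_encode (0, 0) \<and> y = 0 \<or>
     e = prod_encode (1, 0) \<and> y = Suc x \<or>
     e = prod_encode (2, 0) \<and> y = pr1 x \<or>
     e = prod_encode (3, 0) \<and> y = pr2 x \<or>
     pr1 e = 4 \<and> in_stage c (pr1 (pr2 e)) x (pr1 y) \<and> in_stage c (pr2 (pr2 e)) x (pr2 y) \<or>
     pr1 e = 5 \<and> (\<exists>v<b. in_stage c (pr2 (pr2 e)) x v \<and> in_stage c (pr1 (pr2 e)) v y) \<or>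
     pr1 e = 6 \<and> pr2 x = 0 \<and> in_stage c (pr1 (pr2 e)) (pr1 x) y \<or>
     pr1 e = 6 \<and> pr2 x \<noteq> 0 \<and> (\<exists>v<b. in_stage c e (prod_encode (pr1 x, pr2 x - 1)) v \<and>
       in_stage c (pr2 (pr2 e)) (prod_encode (pr1 x, prod_encode (pr2 x - 1, v))) y) \<or>
     pr1 e = 7 \<and> in_stage c (pr2 e) (prod_encode (x, y)) 0 \<and>
       (\<forall>m<y. \<exists>v<b. in_stage c (pr2 e) (prod_encode (x, m)) (Suc v))"

definition stage :: "nat \<Rightarrow> nat" where
  "stage k = rec_nat 0 (\<lambda>k c. list_encode
     (map (\<lambda>t. of_bool (derivable c k (pr1 t) (pr1 (pr2 t)) (pr2 (pr2 t)))) [0..<Suc k])) k"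

definition evals_in :: "nat \<Rightarrow> nat \<Rightarrow> nat \<Rightarrow> nat \<Rightarrow> bool" where
  "evals_in k = in_stage (stage k)"

definition evals :: "nat \<Rightarrow> nat \<Rightarrow> nat \<Rightarrow> bool" where
  "evals e x y \<longleftrightarrow> (\<exists>k. evals_in k e x y)"

lemma decidable_in_stage [comp_intros]:
  "computable_fun c \<Longrightarrow> computable_fun e \<Longrightarrow> computable_fun f \<Longrightarrow> computable_fun g \<Longrightarrow>
    decidable (\<lambda>x. in_stage (c x) (e x) (f x) (g x))"
  unfolding in_stage_def by (intro comp_intros)

lemma decidable_derivable [comp_intros]:
  assumes "computable_fun c" "computable_fun b" "computable_fun e" "computable_fun f" "computable_fun g"
  shows "decidable (\<lambda>x. derivable (c x) (b x) (e x) (f x) (g x))"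
  unfolding derivable_def by (intro comp_intros assms assms[THEN computable_fun_comp])

lemma computable_fun_stage [comp_intros]:
  "computable_fun k \<Longrightarrow> computable_fun (\<lambda>x. stage (k x))"
  unfolding stage_def by (intro comp_intros)

lemma decidable_evals_in [comp_intros]:
  "computable_fun k \<Longrightarrow> computable_fun e \<Longrightarrow> computable_fun f \<Longrightarrow> computable_fun g \<Longrightarrow>
    decidable (\<lambda>x. evals_in (k x) (e x) (f x) (g x))"
  unfolding evals_in_def by (intro comp_intros)

lemma semidecidable_evals [semi_intros]:
  assumes "computable_fun e" "computable_fun f" "computable_fun g"
  shows "semidecidable (\<lambda>x. evals (e x) (f x) (g x))"
  unfolding evals_def
  by (intro semidecidable_ex decidable_imp_semidecidable comp_intros assms[THEN computable_fun_comp])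

section \<open>Soundness, completeness and single-valuedness of the stages\<close>

lemma evals_in_0 [simp]: "\<not> evals_in 0 e x y"
  by (simp add: evals_in_def in_stage_def stage_def nth_code_beyond length_code_def)

lemma evals_in_Suc: "evals_in (Suc k) e x y \<longleftrightarrow>
    prod_encode (e, prod_encode (x, y)) < Suc k \<and> derivable (stage k) k e x y"
proof -
  let ?f = "\<lambda>t. of_bool (derivable (stage k) k (pr1 t) (pr1 (pr2 t)) (pr2 (pr2 t))) :: nat"
  have "stage (Suc k) = list_encode (map ?f [0..<Suc k])"
    by (simp add: stage_def)
  then show ?thesis
    by (cases "prod_encode (e, prod_encode (x, y)) < Suc k")
      (simp_all add: evals_in_def in_stage_def nth_code_encode nth_code_beyond nth_append del: upt_Suc)
qed

text \<open>The induction is on the stage and not on p, because the clause for primitive recursion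
  refers back to the same program at a smaller argument.\<close>

lemma evals_in_sound: "evals_in k (goedel p) x y \<Longrightarrow> run p x = Some y"
proof (induction k arbitrary: p x y)
  case (Suc k)
  then have d: "derivable (stage k) k (goedel p) x y" by (simp add: evals_in_Suc)
  note IH = Suc.IH[unfolded evals_in_def]
  show ?case
  proof (cases p)
    case (Pairing f g)
    then show ?thesis using d by (auto simp: derivable_def dest!: IH)
  next
    case (Comp f g)
    then show ?thesis using d by (auto simp: derivable_def dest!: IH)
  next
    case (Prec f g)
    obtain a n where x: "x = prod_encode (a, n)" by (metis prod_decode_inverse surj_pair)
    have p: "prod_encode (6, prod_encode (goedel f, goedel g)) = goedel p" using Prec by simp
    show ?thesis
    proof (cases n)
      case 0
      then show ?thesis using d Prec x by (auto simp: derivable_def dest!: IH)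
    next
      case (Suc m)
      then obtain v where "in_stage (stage k) (goedel p) (prod_encode (a, m)) v"
        "in_stage (stage k) (goedel g) (prod_encode (a, prod_encode (m, v))) y"
        using d Prec x by (auto simp: derivable_def)
      from this[THEN IH] show ?thesis using Prec x Suc by simp
    qed
  next
    case (Mu f)
    then have 0: "run f (prod_encode (x, y)) = Some 0"
      and less: "\<forall>m<y. \<exists>v. run f (prod_encode (x, m)) = Some (Suc v)"
      using d by (auto simp: derivable_def dest!: IH)
    then have "(LEAST n. run f (prod_encode (x, n)) = Some 0) = y"
      by (intro Least_equality) (auto simp: not_less[symmetric])
    with 0 less Mu show ?thesis by fastforce
  qed (use d in \<open>auto simp: derivable_def\<close>)
qed simp

text \<open>Stating completeness with \<open>eventually\<close> replaces a proof that the stages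
  increase: finitely many premises that hold from some stage on hold jointly from some stage
  on.\<close>

lemma eventually_evals_in:
  assumes "\<forall>\<^sub>F k in sequentially. derivable (stage k) k e x y"
  shows "\<forall>\<^sub>F k in sequentially. evals_in k e x y"
proof -
  have "\<forall>\<^sub>F k in sequentially. prod_encode (e, prod_encode (x, y)) < Suc k"
    by (auto simp: eventually_sequentially less_Suc_eq_le)
  with assms have "\<forall>\<^sub>F k in sequentially. evals_in (Suc k) e x y"
    by eventually_elim (simp add: evals_in_Suc)
  then show ?thesis by (subst (asm) eventually_sequentially_Suc)
qed

lemma evals_in_complete:
  "run p x = Some y \<Longrightarrow> \<forall>\<^sub>F k in sequentially. evals_in k (goedel p) x y"
proof (induction p arbitrary: x y)
  case (Pairing f g)
  then obtain a b where "run f x = Some a" "run g x = Some b" and y: "y = prod_encode (a, b)"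
    by (auto simp: bind_eq_Some_conv)
  from Pairing.IH(1)[OF this(1)] Pairing.IH(2)[OF this(2)] show ?case
    by (intro eventually_evals_in, eventually_elim) (simp add: derivable_def evals_in_def y)
next
  case (Comp f g)
  then obtain v where "run g x = Some v" "run f v = Some y"
    by (auto simp: bind_eq_Some_conv)
  from Comp.IH(2)[OF this(1)] Comp.IH(1)[OF this(2)] eventually_gt_at_top[of v] show ?case
    by (intro eventually_evals_in, eventually_elim) (auto simp: derivable_def evals_in_def)
next
  case (Prec f g)
  obtain a n where x: "x = prod_encode (a, n)" by (metis prod_decode_inverse surj_pair)
  show ?case using Prec.prems unfolding x
  proof (induction n arbitrary: y)
    case 0
    then have "run f a = Some y" by simp
    from Prec.IH(1)[OF this] show ?case
      by (intro eventually_evals_in, eventually_elim) (simp add: derivable_def evals_in_def)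
  next
    case (Suc n)
    then obtain v where "run (Prec f g) (prod_encode (a, n)) = Some v"
      "run g (prod_encode (a, prod_encode (n, v))) = Some y"
      by (auto simp: bind_eq_Some_conv)
    from Suc.IH[OF this(1)] Prec.IH(2)[OF this(2)] eventually_gt_at_top[of v] show ?case
      by (intro eventually_evals_in, eventually_elim) (auto simp: derivable_def evals_in_def)
  qed
next
  case (Mu f)
  let ?P = "\<lambda>n. run f (prod_encode (x, n)) = Some 0"
  obtain n where n: "?P n" "\<forall>m<n. run f (prod_encode (x, m)) \<noteq> None" and y: "y = Least ?P"
    using Mu.prems by (auto split: if_splits)
  have 0: "?P y" unfolding y by (rule LeastI) (rule n)
  have "y \<le> n" unfolding y by (rule Least_le) (rule n)
  have ex: "\<forall>m<y. \<exists>v. run f (prod_encode (x, m)) = Some (Suc v)"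
  proof (intro allI impI)
    fix m assume "m < y"
    then have "run f (prod_encode (x, m)) \<noteq> Some 0" unfolding y by (rule not_less_Least)
    moreover obtain w where "run f (prod_encode (x, m)) = Some w"
      using n(2) \<open>m < y\<close> \<open>y \<le> n\<close> by fastforce
    ultimately show "\<exists>v. run f (prod_encode (x, m)) = Some (Suc v)"
      by (cases w) auto
  qed
  then obtain v where "\<And>m. m < y \<Longrightarrow> run f (prod_encode (x, m)) = Some (Suc (v m))" by metis
  note v = Mu.IH[OF this]
  have "\<forall>\<^sub>F k in sequentially. v m < k \<and> evals_in k (goedel f) (prod_encode (x, m)) (Suc (v m))"
    if "m < y" for m
    using v[OF that] eventually_gt_at_top[of "v m"] by eventually_elim simp
  then have "\<forall>\<^sub>F k in sequentially. \<forall>m\<in>{..<y}.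
      v m < k \<and> evals_in k (goedel f) (prod_encode (x, m)) (Suc (v m))"
    by (intro eventually_ball_finite) auto
  with Mu.IH[OF 0] show ?case
    by (intro eventually_evals_in, eventually_elim) (auto simp: derivable_def evals_in_def)
qed (auto intro!: eventually_evals_in simp: derivable_def)

lemma evals_goedel_iff: "evals (goedel p) x y \<longleftrightarrow> run p x = Some y"
proof
  assume "run p x = Some y"
  from evals_in_complete[OF this] show "evals (goedel p) x y"
    unfolding evals_def eventually_sequentially by blast
qed (auto simp: evals_def dest: evals_in_sound)

text \<open>The converse can fail when e codes no program. Together with \<open>evals_unique\<close>
  this inclusion shows that \<open>evals e\<close> is the graph of \<open>phi e\<close> whenever
  \<open>phi e\<close> is total.\<close>

lemma phi_imp_evals: "phi e x = Some y \<Longrightarrow> evals e x y"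
  by (auto simp: phi_def evals_goedel_iff[symmetric] f_inv_into_f split: if_splits)

lemma semidecidable_graph:
  assumes "partial_computable f" "computable_fun g" "computable_fun h"
  shows "semidecidable (\<lambda>x. f (g x) = Some (h x))"
proof -
  obtain p where p: "run p = f" using assms(1) by (auto simp: partial_computable_def)
  have "semidecidable (\<lambda>x. evals (goedel p) (g x) (h x))"
    by (intro semi_intros comp_intros assms)
  then show ?thesis by (simp add: evals_goedel_iff p)
qed

lemma ce_set_Collect_iff: "ce_set {x. P x} \<longleftrightarrow> semidecidable P"
proof
  assume "ce_set {x. P x}"
  then obtain f where f: "partial_computable f" "{x. P x} = dom f" by (auto simp: ce_set_def)
  have "semidecidable (\<lambda>x. \<exists>y. f x = Some y)"
    by (intro semi_intros semidecidable_graph f(1) comp_intros)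
  also have "(\<lambda>x. \<exists>y. f x = Some y) = P" using f(2) by (auto simp: fun_eq_iff dom_def)
  finally show "semidecidable P" .
next
  assume "semidecidable P"
  then have "semidecidable (\<lambda>z. P (pr1 z))"
    by (rule semidecidable_comp) (intro comp_intros)
  then obtain f where "partial_computable f" "\<And>x y. f x = Some y \<Longrightarrow> P x" "\<And>x y. P x \<Longrightarrow> f x \<noteq> None"
    by (rule semidecidable_uniformization[of "\<lambda>x _. P x"]) blast
  then show "ce_set {x. P x}" unfolding ce_set_def by (intro exI[of _ f]) auto
qed

lemma ce_set_iff: "ce_set A \<longleftrightarrow> semidecidable (\<lambda>x. x \<in> A)"
  using ce_set_Collect_iff[of "\<lambda>x. x \<in> A"] by simp

text \<open>Determinism of \<open>run\<close> cannot be invoked, since e may code no program; it is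
  re-proved on derivations, with independent stages on the two sides. For minimisation, the smaller
  of two different results would have both 0 and a successor as its value.\<close>

lemma evals_in_unique: "evals_in k e x y \<Longrightarrow> evals_in k' e x y' \<Longrightarrow> y = y'"
proof (induction k arbitrary: e x y k' y')
  case (Suc k)
  then obtain j where k': "k' = Suc j" by (cases k') auto
  have d: "derivable (stage k) k e x y" "derivable (stage j) j e x y'"
    using Suc.prems by (simp_all add: evals_in_Suc k')
  have IH: "in_stage (stage k) e x y \<Longrightarrow> in_stage (stage j) e x y' \<Longrightarrow> y = y'" for e x y y'
    using Suc.IH unfolding evals_in_def by blast
  have tag: "pr1 e \<in> {0, 1, 2, 3, 4, 5, 6, 7}"
    using d(1) by (auto simp: derivable_def)
  \<comment> \<open>Puts the first four clauses into the same form as the others, so that the tag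
    \<open>pr1 e\<close> alone decides which clause applies.\<close>
  have tagged: "e = prod_encode (c, d) \<longleftrightarrow> pr1 e = c \<and> pr2 e = d" for c d
    by (metis fst_conv prod.collapse prod_decode_inverse prod_encode_inverse snd_conv)
  consider "pr1 e < 4" | "pr1 e = 4" | "pr1 e = 5" | "pr1 e = 6" | "pr1 e = 7"
    using tag by force
  then show ?case
  proof cases
    case 1
    then show ?thesis using d unfolding derivable_def tagged by auto
  next
    case 2
    then have "pr1 y = pr1 y'" "pr2 y = pr2 y'"
      using d unfolding derivable_def tagged by (auto dest: IH)
    then show ?thesis by (metis prod.collapse prod_decode_inverse)
  next
    case 3
    then show ?thesis using d unfolding derivable_def tagged by (auto dest: IH)
  next
    case 4
    then show ?thesis using d unfolding derivable_def tagged
      by (cases "pr2 x = 0") (auto dest: IH)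
  next
    case 5
    then have y: "in_stage (stage k) (pr2 e) (prod_encode (x, y)) 0"
        "\<And>m. m < y \<Longrightarrow> \<exists>v. in_stage (stage k) (pr2 e) (prod_encode (x, m)) (Suc v)"
      and y': "in_stage (stage j) (pr2 e) (prod_encode (x, y')) 0"
        "\<And>m. m < y' \<Longrightarrow> \<exists>v. in_stage (stage j) (pr2 e) (prod_encode (x, m)) (Suc v)"
      using d unfolding derivable_def tagged by auto
    show ?thesis
      using y y' by (metis IH linorder_neqE_nat nat.distinct(1))
  qed
qed simp

lemma evals_unique: "evals e x y \<Longrightarrow> evals e x y' \<Longrightarrow> y = y'"
  unfolding evals_def using evals_in_unique by blast

section \<open>Coded strings\<close>

definition is_string :: "nat \<Rightarrow> bool" where
  "is_string z \<longleftrightarrow> (\<forall>i<length_code z. nth_code z i < 2)"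

lemma decidable_is_string [comp_intros]:
  assumes "computable_fun f"
  shows "decidable (\<lambda>x. is_string (f x))"
  unfolding is_string_def by (intro comp_intros assms computable_fun_comp[OF assms])

lemma length_code_str_code [simp]: "length_code (str_code \<sigma>) = length \<sigma>"
  by (simp add: str_code_def)

lemma nth_code_str_code [simp]: "i < length \<sigma> \<Longrightarrow> nth_code (str_code \<sigma>) i = of_bool (\<sigma> ! i)"
  by (simp add: str_code_def nth_code_encode)

lemma take_code_str_code [simp]: "take_code k (str_code \<sigma>) = str_code (take k \<sigma>)"
  by (simp add: str_code_def take_code_eq take_map)

lemma is_string_str_code [simp]: "is_string (str_code \<sigma>)"
  by (simp add: is_string_def)

lemma is_string_iff: "is_string z \<longleftrightarrow> (\<exists>\<sigma>. z = str_code \<sigma>)"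
proof
  assume z: "is_string z"
  have "z = str_code (map (\<lambda>i. nth_code z i = 1) [0..<length_code z])"
  proof (rule code_eqI)
    fix i assume "i < length_code z"
    with z have "nth_code z i < 2" unfolding is_string_def by blast
    with \<open>i < length_code z\<close>
    show "nth_code z i = nth_code (str_code (map (\<lambda>i. nth_code z i = 1) [0..<length_code z])) i"
      by (auto simp: of_bool_def)
  qed simp
  then show "\<exists>\<sigma>. z = str_code \<sigma>" ..
qed auto

text \<open>The code of the string of n ones, which is the largest code of a string of length n. It
  bounds searches over all strings of that length.\<close>

definition string_bound :: "nat \<Rightarrow> nat" where
  "string_bound n = rec_nat 0 (\<lambda>_ r. Suc (prod_encode (1, r))) n"

lemma computable_fun_string_bound [comp_intros]:
  "computable_fun f \<Longrightarrow> computable_fun (\<lambda>x. string_bound (f x))"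
  unfolding string_bound_def by (intro comp_intros)

lemma triangle_mono: "m \<le> n \<Longrightarrow> triangle m \<le> triangle n"
  unfolding triangle_def by (intro div_le_mono mult_le_mono) auto

lemma prod_encode_mono: "a \<le> b \<Longrightarrow> c \<le> d \<Longrightarrow> prod_encode (a, c) \<le> prod_encode (b, d)"
  unfolding prod_encode_def by (simp add: add_mono triangle_mono)

lemma str_code_le_string_bound: "str_code \<sigma> \<le> string_bound (length \<sigma>)"
proof (induction \<sigma>)
  case (Cons b \<sigma>)
  then show ?case
    by (auto simp: str_code_def string_bound_def intro!: prod_encode_mono)
qed (simp add: str_code_def string_bound_def)

lemma length_init_seg [simp]: "length (init_seg X n) = n"
  by (simp add: init_seg_def)

lemma nth_init_seg [simp]: "i < n \<Longrightarrow> init_seg X n ! i = X i"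
  by (simp add: init_seg_def)

lemma take_init_seg: "take m (init_seg X n) = init_seg X (min m n)"
  by (simp add: init_seg_def take_map take_upt min_def)

lemma init_seg_eq_iff: "init_seg X n = init_seg Y n \<longleftrightarrow> (\<forall>i<n. X i = Y i)"
  by (auto simp: list_eq_iff_nth_eq)

lemma init_seg_eq_mono: "init_seg X n = init_seg Y n \<Longrightarrow> m \<le> n \<Longrightarrow> init_seg X m = init_seg Y m"
  by (simp add: init_seg_eq_iff)

lemma mem_cylinder_iff: "X \<in> cylinder \<sigma> \<longleftrightarrow> init_seg X (length \<sigma>) = \<sigma>"
  by (simp add: cylinder_def)

lemma mem_cylinder_nth: "X \<in> cylinder \<sigma> \<longleftrightarrow> (\<forall>i<length \<sigma>. X i = \<sigma> ! i)"
  by (auto simp: mem_cylinder_iff list_eq_iff_nth_eq)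

lemma cylinder_take_subset: "cylinder \<sigma> \<subseteq> cylinder (take n \<sigma>)"
  by (auto simp: mem_cylinder_nth)

section \<open>Indices of computable sequences and criteria for hyperavoidability\<close>

lemma index_of_imp_computable: "index_of e M \<Longrightarrow> computable_seq M"
  unfolding index_of_def computable_seq_def computable_fun_def partial_computable_def phi_def
  by (rule exI[of _ "inv goedel e"]) (auto simp: fun_eq_iff split: if_splits)

lemma computable_seq_index:
  assumes "computable_seq M" obtains e where "index_of e M"
proof -
  obtain p where "run p = (\<lambda>n. Some (of_bool (M n)))"
    using assms by (auto simp: computable_seq_def elim: computable_funE)
  then have "index_of (goedel p) M" by (simp add: index_of_def)
  then show ?thesis by (rule that)
qed

lemma avoidable_via_iff:
  assumes "partial_computable p"
  shows "avoidable_via X p \<longleftrightarrow>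
    (\<forall>M e. index_of e M \<longrightarrow> (\<exists>n. p e = Some n \<and> init_seg X n \<noteq> init_seg M n))"
  unfolding avoidable_via_def using assms index_of_imp_computable by blast

lemma avoidable_imp_noncomputable: "avoidable X \<Longrightarrow> \<not> computable_seq X"
  unfolding avoidable_def avoidable_via_def by (metis computable_seq_index)

lemma hyperavoidable_imp_avoidable: "hyperavoidable X \<Longrightarrow> avoidable X"
  unfolding hyperavoidable_def avoidable_def by blast

lemma hyperavoidableI:
  assumes "computable_fun p" "\<And>M e. index_of e M \<Longrightarrow> init_seg X (p e) \<noteq> init_seg M (p e)"
  shows "hyperavoidable X"
proof -
  have "avoidable_via X (\<lambda>e. Some (p e))"
    using assms by (subst avoidable_via_iff) (auto simp: computable_fun_def)
  then show ?thesis unfolding hyperavoidable_def by (intro exI[of _ "\<lambda>e. Some (p e)"]) simp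
qed

text \<open>An index belongs to at most one sequence, which is computable and so differs from X
  somewhere. For the indices below k these differences lie below a common N. Adding N to p repairs
  those indices and does no harm at the others, as a difference persists in longer segments.\<close>

lemma hyperavoidable_almost_allI:
  assumes "computable_fun p" "\<not> computable_seq X"
    and "\<And>M e. e \<ge> k \<Longrightarrow> index_of e M \<Longrightarrow> init_seg X (p e) \<noteq> init_seg M (p e)"
  shows "hyperavoidable X"
proof -
  have "\<exists>N. \<forall>e<j. \<forall>M. index_of e M \<longrightarrow> init_seg X N \<noteq> init_seg M N" for j
  proof (induction j)
    case (Suc j)
    then obtain N where N: "\<And>e M. e < j \<Longrightarrow> index_of e M \<Longrightarrow> init_seg X N \<noteq> init_seg M N" by blast
    obtain N' where N': "\<And>M. index_of j M \<Longrightarrow> init_seg X N' \<noteq> init_seg M N'"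
    proof (cases "\<exists>M. index_of j M")
      case True
      then obtain M where M: "index_of j M" by blast
      with assms(2) have "X \<noteq> M" using index_of_imp_computable by blast
      then obtain i where "X i \<noteq> M i" by blast
      then have "init_seg X (Suc i) \<noteq> init_seg M (Suc i)" by (auto simp: init_seg_eq_iff)
      moreover have "M' = M" if "index_of j M'" for M'
        using M that by (auto simp: index_of_def fun_eq_iff of_bool_def split: if_splits)
      ultimately show ?thesis using that[of "Suc i"] by blast
    qed (use that in blast)
    have "init_seg X (max N N') \<noteq> init_seg M (max N N')" if "e < Suc j" "index_of e M" for e M
    proof (cases "e = j")
      case True
      then show ?thesis using N'[of M] that(2) init_seg_eq_mono[of X "max N N'" M N'] by auto
    next
      case False
      then show ?thesis using N[of e M] that init_seg_eq_mono[of X "max N N'" M N] by auto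
    qed
    then show ?case by blast
  qed simp
  then obtain N where N: "\<And>e M. e < k \<Longrightarrow> index_of e M \<Longrightarrow> init_seg X N \<noteq> init_seg M N" by blast
  show ?thesis
  proof (rule hyperavoidableI)
    show "computable_fun (\<lambda>e. N + p e)" by (intro comp_intros assms(1))
    fix M e assume e: "index_of e M"
    show "init_seg X (N + p e) \<noteq> init_seg M (N + p e)"
    proof (cases "e < k")
      case True
      then show ?thesis using N[OF _ e] init_seg_eq_mono[of X "N + p e" M N] by auto
    next
      case False
      then show ?thesis using assms(3)[OF _ e] init_seg_eq_mono[of X "N + p e" M "p e"] by auto
    qed
  qed
qed

section \<open>Avoidable sequences are not semigeneric\<close>

text \<open>The s-m-n function: from a code c of q it forms a code of the program x |-> q<a, x>, in
  which the identity is written \<open>Pairing Proj1 Proj2\<close> and the inner recursion yields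
  the code of \<open>const_prog a\<close>. Working on codes makes it visibly computable.\<close>

definition smn :: "nat \<Rightarrow> nat \<Rightarrow> nat" where
  "smn c a = prod_encode (5, prod_encode (c, prod_encode (4, prod_encode
     (rec_nat (goedel Zero) (\<lambda>_ r. prod_encode (5, prod_encode (goedel Succ, r))) a,
      goedel (Pairing Proj1 Proj2)))))"

lemma computable_fun_smn [comp_intros]:
  "computable_fun f \<Longrightarrow> computable_fun g \<Longrightarrow> computable_fun (\<lambda>x. smn (f x) (g x))"
  unfolding smn_def by (intro comp_intros)

lemma smn_eq: "smn (goedel q) a = goedel (Comp q (Pairing (const_prog a) (Pairing Proj1 Proj2)))"
proof -
  have "rec_nat (goedel Zero) (\<lambda>_ r. prod_encode (5, prod_encode (goedel Succ, r))) a
      = goedel (const_prog a)"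
    by (induction a) simp_all
  then show ?thesis by (simp add: smn_def)
qed

text \<open>Kleene's self-application with a parameter e, for a relation R whose first argument is
  the index under construction. The program q reads <<c, e>, x> and takes
  \<open>smn c <c, e>\<close> for its own index; this is correct when c is the code of q, which is
  how \<open>E e\<close> feeds it.\<close>

lemma recursion_theorem:
  assumes "semidecidable (\<lambda>z. R (pr1 z) (pr1 (pr2 z)) (pr1 (pr2 (pr2 z))) (pr2 (pr2 (pr2 z))))"
  obtains E where "computable_fun E" "\<And>e x y. phi (E e) x = Some y \<Longrightarrow> R (E e) e x y"
    "\<And>e x y. R (E e) e x y \<Longrightarrow> phi (E e) x \<noteq> None"
proof -
  let ?R = "\<lambda>z y. R (smn (pr1 (pr1 z)) (pr1 z)) (pr2 (pr1 z)) (pr2 z) y"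
  have "semidecidable (\<lambda>z. ?R (pr1 z) (pr2 z))"
    using semidecidable_comp[OF assms, of "\<lambda>z. prod_encode (smn (pr1 (pr1 (pr1 z))) (pr1 (pr1 z)),
      prod_encode (pr2 (pr1 (pr1 z)), prod_encode (pr2 (pr1 z), pr2 z)))"]
    by (simp add: comp_intros)
  then obtain f where f: "partial_computable f" "\<And>x y. f x = Some y \<Longrightarrow> ?R x y"
      "\<And>x y. ?R x y \<Longrightarrow> f x \<noteq> None"
    by (rule semidecidable_uniformization) blast
  obtain q where q: "run q = f" using f(1) by (auto simp: partial_computable_def)
  define E where "E e = smn (goedel q) (prod_encode (goedel q, e))" for e
  have phi: "phi (E e) x = f (prod_encode (prod_encode (goedel q, e), x))" for e x
    unfolding E_def smn_eq phi_goedel by (simp add: q)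
  show ?thesis
  proof (rule that)
    show "computable_fun E" unfolding E_def by (intro comp_intros)
    show "R (E e) e x y" if "phi (E e) x = Some y" for e x y
      using f(2)[OF that[unfolded phi]] by (simp add: E_def)
    show "phi (E e) x \<noteq> None" if "R (E e) e x y" for e x y
      unfolding phi using that by (intro f(3)) (simp add: E_def)
  qed
qed

lemma avoidable_imp_separating_sigma1_class:
  assumes "avoidable X"
  obtains V where "sigma1_class V" "X \<notin> V" "\<And>Y. computable_seq Y \<Longrightarrow> Y \<in> V"
proof -
  obtain p where p: "avoidable_via X p" using assms by (auto simp: avoidable_def)
  then have "partial_computable p" by (simp add: avoidable_via_def)
  then obtain q where q: "run q = p" by (auto simp: partial_computable_def)
  define H where "H s e n \<longleftrightarrow> evals_in s (goedel q) e n" for s e n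
  have H_iff: "p e = Some n \<longleftrightarrow> (\<exists>s. H s e n)" for e n
    using evals_goedel_iff[of q] by (simp add: q H_def evals_def)
  \<comment> \<open>The condition persists as m grows, and it fails at every m below the value of p
    at e.\<close>
  define D where "D e m \<longleftrightarrow> (\<exists>s<Suc m. \<exists>n<Suc m. H s e n)" for e m
  define R where "R e' e m v \<longleftrightarrow> D e' m \<and> v = 0 \<or> \<not> D e' m \<and> evals e m v" for e' e m v
  have "semidecidable (\<lambda>z. R (pr1 z) (pr1 (pr2 z)) (pr1 (pr2 (pr2 z))) (pr2 (pr2 (pr2 z))))"
    unfolding R_def D_def H_def
    by (intro semidecidable_disj semidecidable_conj semidecidable_evals comp_intros)
      (intro decidable_imp_semidecidable comp_intros)+
  then obtain E where E: "computable_fun E" "\<And>e x y. phi (E e) x = Some y \<Longrightarrow> R (E e) e x y"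
    "\<And>e x y. R (E e) e x y \<Longrightarrow> phi (E e) x \<noteq> None"
    by (rule recursion_theorem) blast
  have phi_E: "phi (E e) m = Some v" if v: "R (E e) e m v" for e m v
  proof -
    obtain w where w: "phi (E e) m = Some w" using E(3)[OF v] by blast
    with E(2)[OF w] v have "v = w" unfolding R_def using evals_unique by auto
    with w show ?thesis by simp
  qed
  have total: "index_of (E e) (\<lambda>m. \<not> D (E e) m \<and> Y m)"
    if "\<And>m. \<not> D (E e) m \<Longrightarrow> evals e m (of_bool (Y m))" for e Y
    unfolding index_of_def
  proof (intro allI phi_E)
    show "R (E e) e m (of_bool (\<not> D (E e) m \<and> Y m))" for m
      using that[of m] by (cases "D (E e) m") (simp_all add: R_def)
  qed
  \<comment> \<open>From position s + n on \<open>D (E e)\<close> holds and the value is 0 by fiat.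
    A string of that length thus covers every position where \<open>phi (E e)\<close> still consults
    \<open>evals e\<close>.\<close>
  define W where "W = {z. \<exists>e s n. H s (E e) n \<and> is_string z \<and> length_code z = s + n \<and>
    (\<forall>i<length_code z. evals e i (nth_code z i))}"
  define V where "V = \<Union>{cylinder \<sigma> |\<sigma>. str_code \<sigma> \<in> W}"
  show ?thesis
  proof (rule that)
    have "ce_set W" unfolding W_def ce_set_Collect_iff H_def
      by (intro semidecidable_ex semidecidable_conj semidecidable_all_less semidecidable_evals comp_intros)
        (intro decidable_imp_semidecidable comp_intros computable_fun_comp[OF E(1)])+
    then show "sigma1_class V" unfolding sigma1_class_def V_def by blast
  next
    show "X \<notin> V"
    proof
      assume "X \<in> V"
      then obtain \<sigma> e s n where X: "X \<in> cylinder \<sigma>" and H: "H s (E e) n" and len: "length \<sigma> = s + n"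
        and ev: "\<forall>i<s + n. evals e i (of_bool (\<sigma> ! i))"
        unfolding V_def W_def by fastforce
      have D: "D (E e) m" if "m \<ge> s + n" for m
        unfolding D_def using H that by (intro exI[of _ s] conjI exI[of _ n]) auto
      have pn: "p (E e) = Some n" using H H_iff by blast
      \<comment> \<open>If X were in V, this finite part of X followed by zeros would have index
        \<open>E e\<close>, although it agrees with X below n, the value of p at that index.\<close>
      let ?M = "\<lambda>m. \<not> D (E e) m \<and> X m"
      have "index_of (E e) ?M"
      proof (rule total)
        fix m assume "\<not> D (E e) m"
        then have "m < s + n" using D not_less by blast
        then show "evals e m (of_bool (X m))"
          using ev X len by (simp add: mem_cylinder_nth)
      qed
      then have "init_seg X n \<noteq> init_seg ?M n"
        using p pn index_of_imp_computable unfolding avoidable_via_def by fastforce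
      moreover have "\<not> D (E e) i" if "i < n" for i
      proof
        assume "D (E e) i"
        then obtain s' n' where "n' \<le> i" "H s' (E e) n'" unfolding D_def by (auto simp: less_Suc_eq_le)
        then show False using pn H_iff[of "E e" n'] that by auto
      qed
      ultimately show False by (simp add: init_seg_eq_iff)
    qed
  next
    fix Y assume "computable_seq Y"
    then obtain e where e: "index_of e Y" by (rule computable_seq_index)
    have ev: "evals e m (of_bool (Y m))" for m
      using e by (intro phi_imp_evals) (simp add: index_of_def)
    have "index_of (E e) (\<lambda>m. \<not> D (E e) m \<and> Y m)" by (rule total) (rule ev)
    then obtain n where "p (E e) = Some n"
      using p index_of_imp_computable unfolding avoidable_via_def by blast
    then obtain s where "H s (E e) n" using H_iff by blast
    then have "str_code (init_seg Y (s + n)) \<in> W"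
      unfolding W_def mem_Collect_eq using ev
      by (intro exI[where x = e] exI[where x = s] exI[where x = n] conjI) simp_all
    moreover have "Y \<in> cylinder (init_seg Y (s + n))" by (simp add: mem_cylinder_iff)
    ultimately show "Y \<in> V" unfolding V_def by blast
  qed
qed

lemma not_semigeneric_iff:
  assumes "\<not> computable_seq X"
  shows "\<not> semigeneric X \<longleftrightarrow>
    (\<exists>V. sigma1_class V \<and> X \<notin> V \<and> (\<forall>Y. computable_seq Y \<longrightarrow> Y \<in> V))" (is "_ \<longleftrightarrow> ?rhs")
proof
  assume "\<not> semigeneric X"
  then obtain C where "pi1_class C" "X \<in> C" "\<forall>Y\<in>C. \<not> computable_seq Y"
    using assms by (auto simp: semigeneric_def)
  then show ?rhs by (intro exI[of _ "- C"]) (auto simp: pi1_class_def)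
next
  assume ?rhs
  then obtain V where V: "sigma1_class V" "X \<notin> V" "\<And>Y. computable_seq Y \<Longrightarrow> Y \<in> V" by blast
  then have "pi1_class (- V)" by (simp add: pi1_class_def)
  with V show "\<not> semigeneric X" unfolding semigeneric_def by blast
qed

section \<open>Complex sequences are hyperavoidable\<close>

lemma prefix_free_machineI:
  assumes "partial_computable h" "\<And>x y. h x = Some y \<Longrightarrow> is_string y"
    "\<And>\<tau> \<tau>'. h (str_code \<tau>) \<noteq> None \<Longrightarrow> h (str_code \<tau>') \<noteq> None \<Longrightarrow> prefix \<tau> \<tau>' \<Longrightarrow> \<tau> = \<tau>'"
  shows "prefix_free_machine (\<lambda>\<tau>. map_option (inv str_code) (h (str_code \<tau>)))"
proof -
  obtain p where p: "run p = h" using assms(1) by (auto simp: partial_computable_def)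
  have "run p (str_code \<tau>) = map_option str_code (map_option (inv str_code) (h (str_code \<tau>)))" for \<tau>
  proof (cases "h (str_code \<tau>)")
    case (Some y)
    then have "y \<in> range str_code" using assms(2)[OF Some] by (auto simp: is_string_iff)
    then show ?thesis using Some by (simp add: p f_inv_into_f)
  qed (simp add: p)
  then show ?thesis unfolding prefix_free_machine_def dom_def
    using assms(3) by (auto intro!: exI[of _ p])
qed

lemma inv_str_code [simp]: "inv str_code (str_code \<sigma>) = \<sigma>"
  by (rule inv_f_f) (simp add: inj_def)

text \<open>A \<open>LEAST\<close> over an empty set would be meaningless, so every \<sigma> needs a
  description. It comes from the machine that is defined only on the empty string, whose code is 0,
  and outputs \<sigma> there.\<close>

lemma K_witness:
  assumes "universal_prefix_free_machine U"
  obtains \<tau> where "U \<tau> = Some \<sigma>" "length \<tau> = K U \<sigma>"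
proof -
  have "semidecidable (\<lambda>z. pr1 z = 0 \<and> pr2 z = str_code \<sigma>)"
    by (intro decidable_imp_semidecidable comp_intros)
  then obtain h where h: "partial_computable h" "\<And>x y. h x = Some y \<Longrightarrow> x = 0 \<and> y = str_code \<sigma>"
      "\<And>x y. x = 0 \<and> y = str_code \<sigma> \<Longrightarrow> h x \<noteq> None"
    by (rule semidecidable_uniformization[of "\<lambda>x y. x = 0 \<and> y = str_code \<sigma>"]) blast
  let ?M = "\<lambda>\<tau>. map_option (inv str_code) (h (str_code \<tau>))"
  have Nil: "\<tau> = []" if "h (str_code \<tau>) \<noteq> None" for \<tau>
    using that h(2)[of "str_code \<tau>"] str_code_inject[of \<tau> "[]"]
    by (auto simp: str_code_def simp del: str_code_inject)
  have "prefix_free_machine ?M"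
  proof (rule prefix_free_machineI[OF h(1)])
    show "is_string y" if "h x = Some y" for x y using h(2)[OF that] by simp
    show "\<tau> = \<tau>'" if "h (str_code \<tau>) \<noteq> None" "h (str_code \<tau>') \<noteq> None" for \<tau> \<tau>'
      using that[THEN Nil] by simp
  qed
  moreover obtain y where "h 0 = Some y" using h(3)[of 0 "str_code \<sigma>"] by auto
  then have "?M [] = Some \<sigma>" using h(2)[of 0 y] by (simp add: str_code_def[of "[]"])
  ultimately obtain \<tau>' where "U \<tau>' = Some \<sigma>"
    using assms unfolding universal_prefix_free_machine_def by blast
  then have "\<exists>n \<tau>. length \<tau> = n \<and> U \<tau> = Some \<sigma>" by blast
  then have "\<exists>\<tau>. length \<tau> = K U \<sigma> \<and> U \<tau> = Some \<sigma>" unfolding K_def by (rule LeastI_ex)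
  with that show ?thesis by blast
qed

lemma K_le: "U \<tau> = Some \<sigma> \<Longrightarrow> K U \<sigma> \<le> length \<tau>"
  unfolding K_def by (rule Least_le) blast

definition unary :: "nat \<Rightarrow> bool list" where
  "unary e = replicate e True @ [False]"

lemma prefix_unary:
  assumes "prefix (unary a) (unary b)"
  shows "a = b"
proof (rule ccontr)
  assume "a \<noteq> b"
  moreover have "a \<le> b" using prefix_length_le[OF assms] by (simp add: unary_def)
  ultimately have "unary b ! a" by (simp add: unary_def nth_append)
  moreover obtain \<rho> where "unary b = unary a @ \<rho>" using assms by (auto simp: prefix_def)
  then have "\<not> unary b ! a" by (simp add: unary_def nth_append)
  ultimately show False by blast
qed

lemma unary_inject [simp]: "unary a = unary b \<longleftrightarrow> a = b"
  by (metis prefix_unary prefix_order.refl)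

lemma computable_fun_unary [comp_intros]:
  assumes "computable_fun f"
  shows "computable_fun (\<lambda>x. str_code (unary (f x)))"
proof -
  have "str_code (unary k) = rec_nat (str_code [False]) (\<lambda>_ r. Suc (prod_encode (1, r))) k" for k
    by (induction k) (auto simp: unary_def str_code_def)
  then show ?thesis by (simp only:) (intro comp_intros assms)
qed

lemma complex_imp_hyperavoidable:
  assumes U: "universal_prefix_free_machine U" and X: "complex_seq U X" "\<not> computable_seq X"
  shows "hyperavoidable X"
proof -
  obtain f where f: "computable_fun f" "order_fun f" "\<And>n. f n \<le> K U (init_seg X n)"
    using X(1) by (auto simp: complex_seq_def)
  \<comment> \<open>The description of the segment has length e + 1, and simulation adds c. For e
    \<ge> c the total e + 1 + c is at most 2e + 1, strictly below the bound f gives for X; smaller e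
    go to \<open>hyperavoidable_almost_allI\<close>.\<close>
  define n where "n e = (LEAST m. e + e + 1 < f m)" for e
  have "computable_fun n" unfolding n_def using f(2)
    by (intro comp_intros computable_fun_comp[OF f(1)]) (simp add: order_fun_def)
  have n: "e + e + 1 < f (n e)" for e
    unfolding n_def by (rule LeastI_ex) (use f(2) in \<open>simp add: order_fun_def\<close>)
  define R where "R x y \<longleftrightarrow> (\<exists>e. x = str_code (unary e) \<and> is_string y \<and> length_code y = n e \<and>
    (\<forall>i<n e. evals e i (nth_code y i)))" for x y
  have "semidecidable (\<lambda>z. R (pr1 z) (pr2 z))" unfolding R_def
    by (intro semidecidable_ex semidecidable_conj semidecidable_all_less semidecidable_evals
        comp_intros computable_fun_comp[OF \<open>computable_fun n\<close>])
      (intro decidable_imp_semidecidable comp_intros computable_fun_comp[OF \<open>computable_fun n\<close>])+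
  then obtain h where h: "partial_computable h" "\<And>x y. h x = Some y \<Longrightarrow> R x y"
      "\<And>x y. R x y \<Longrightarrow> h x \<noteq> None"
    by (rule semidecidable_uniformization) blast
  let ?M = "\<lambda>\<tau>. map_option (inv str_code) (h (str_code \<tau>))"
  have "prefix_free_machine ?M"
  proof (rule prefix_free_machineI[OF h(1)])
    show "is_string y" if "h x = Some y" for x y using h(2)[OF that] by (auto simp: R_def)
  next
    fix \<tau> \<tau>' assume "h (str_code \<tau>) \<noteq> None" "h (str_code \<tau>') \<noteq> None" and pre: "prefix \<tau> \<tau>'"
    then obtain y y' where "h (str_code \<tau>) = Some y" "h (str_code \<tau>') = Some y'" by blast
    then obtain a b where "\<tau> = unary a" "\<tau>' = unary b"
      using h(2)[of "str_code \<tau>" y] h(2)[of "str_code \<tau>'" y'] by (auto simp: R_def)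
    with pre show "\<tau> = \<tau>'" by (metis prefix_unary)
  qed
  then obtain c where c: "\<And>\<tau> \<sigma>. ?M \<tau> = Some \<sigma> \<Longrightarrow> \<exists>\<tau>'. U \<tau>' = Some \<sigma> \<and> length \<tau>' \<le> length \<tau> + c"
    using U unfolding universal_prefix_free_machine_def by blast
  show ?thesis
  proof (rule hyperavoidable_almost_allI[OF \<open>computable_fun n\<close> X(2)])
    fix M e assume e: "c \<le> e" "index_of e M"
    have ev: "evals e m (of_bool (M m))" for m
      using e(2) by (intro phi_imp_evals) (simp add: index_of_def)
    let ?\<sigma> = "init_seg M (n e)"
    have "R (str_code (unary e)) (str_code ?\<sigma>)"
      unfolding R_def using ev by (intro exI[of _ e]) simp
    then obtain y where y: "h (str_code (unary e)) = Some y" using h(3) by blast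
    with h(2)[OF y] have y': "is_string y" "length_code y = n e" "\<And>i. i < n e \<Longrightarrow> evals e i (nth_code y i)"
      by (auto simp: R_def)
    \<comment> \<open>Uniformization only promises some related value; as \<open>evals e\<close> is
      single-valued, the segment of M is the only candidate.\<close>
    have "y = str_code ?\<sigma>"
    proof (rule code_eqI)
      fix i assume "i < length_code y"
      then have "i < n e" using y'(2) by simp
      then show "nth_code y i = nth_code (str_code ?\<sigma>) i"
        using evals_unique[OF y'(3) ev] by simp
    qed (simp add: y'(2))
    with y have "?M (unary e) = Some ?\<sigma>" by simp
    from c[OF this] obtain \<tau>' where "U \<tau>' = Some ?\<sigma>" "length \<tau>' \<le> e + 1 + c"
      by (auto simp: unary_def)
    then have "K U ?\<sigma> \<le> e + 1 + c" using K_le by fastforce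
    moreover have "e + e + 1 < K U (init_seg X (n e))"
      using n[of e] f(3)[of "n e"] by linarith
    ultimately show "init_seg X (n e) \<noteq> ?\<sigma>" using e(1) by auto
  qed
qed

section \<open>Computable continuous measures\<close>

lemma cantor_measure_prob: "computable_measure \<mu> \<Longrightarrow> prob_space \<mu>"
  by (simp add: computable_measure_def cantor_measure_def)

lemma cantor_measure_sets: "computable_measure \<mu> \<Longrightarrow> sets \<mu> = sets borel"
  by (simp add: computable_measure_def cantor_measure_def)

lemma open_in_sets: "computable_measure \<mu> \<Longrightarrow> open A \<Longrightarrow> A \<in> sets \<mu>"
  by (simp add: cantor_measure_sets)

lemma cylinder_in_sets: "computable_measure \<mu> \<Longrightarrow> cylinder \<sigma> \<in> sets \<mu>"
  by (simp add: cantor_measure_sets open_cylinder)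

lemma measure_cylinder_take_le:
  assumes "computable_measure \<mu>"
  shows "measure \<mu> (cylinder \<sigma>) \<le> measure \<mu> (cylinder (take n \<sigma>))"
proof -
  interpret prob_space \<mu> by (rule cantor_measure_prob[OF assms])
  show ?thesis
    by (rule finite_measure_mono[OF cylinder_take_subset cylinder_in_sets[OF assms]])
qed

lemma Inter_cylinder_init_seg: "(\<Inter>n. cylinder (init_seg X n)) = {X}"
proof
  show "(\<Inter>n. cylinder (init_seg X n)) \<subseteq> {X}"
  proof
    fix Y assume "Y \<in> (\<Inter>n. cylinder (init_seg X n))"
    then have "Y \<in> cylinder (init_seg X (Suc n))" for n by blast
    then have "Y n = X n" for n unfolding mem_cylinder_nth by (metis length_init_seg lessI nth_init_seg)
    then show "Y \<in> {X}" by auto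
  qed
qed (auto simp: mem_cylinder_nth)

lemma measure_singleton_limit:
  assumes "computable_measure \<mu>"
  shows "(\<lambda>n. measure \<mu> (cylinder (init_seg X n))) \<longlonglongrightarrow> measure \<mu> {X}"
proof -
  interpret prob_space \<mu> by (rule cantor_measure_prob[OF assms])
  have "decseq (\<lambda>n. cylinder (init_seg X n))"
    by (auto simp: decseq_def mem_cylinder_nth)
  from finite_Lim_measure_decseq[OF _ this] show ?thesis
    using cylinder_in_sets[OF assms] by (auto simp: Inter_cylinder_init_seg)
qed

lemma measure_singleton_le:
  assumes "computable_measure \<mu>"
  shows "measure \<mu> {X} \<le> measure \<mu> (cylinder (init_seg X n))"
proof -
  interpret prob_space \<mu> by (rule cantor_measure_prob[OF assms])
  show ?thesis
    by (rule finite_measure_mono[OF _ cylinder_in_sets[OF assms]]) (simp add: mem_cylinder_iff)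
qed

text \<open>Comparing a computable real with a rational is not decidable, so a gap is left open. S
  compares an approximation of precision 2^-(j+1) with 2^-j; its error stays inside the gap between
  2^-(j+1) and 2^(1-j).\<close>

lemma computable_measure_threshold:
  assumes "computable_measure \<mu>"
  obtains S where "decidable (\<lambda>z. S (pr1 z) (pr2 z))"
    "\<And>\<sigma> j. measure \<mu> (cylinder \<sigma>) \<le> 1 / 2 ^ Suc j \<Longrightarrow> S (str_code \<sigma>) j"
    "\<And>\<sigma> j. S (str_code \<sigma>) j \<Longrightarrow> measure \<mu> (cylinder \<sigma>) < 2 / 2 ^ j"
proof -
  let ?\<mu> = "\<lambda>\<sigma>. measure \<mu> (cylinder \<sigma>)"
  obtain a b d where abd: "computable_fun a" "computable_fun b" "computable_fun d"
    and approx: "\<And>\<sigma> n. \<bar>?\<mu> \<sigma> - (real (a (prod_encode (str_code \<sigma>, n))) - real (b (prod_encode (str_code \<sigma>, n))))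
      / real (d (prod_encode (str_code \<sigma>, n)) + 1)\<bar> \<le> 1 / 2 ^ n"
    using assms unfolding computable_measure_def computable_real_fun_def Let_def by blast
  \<comment> \<open>The comparison with 2^-j is multiplied out, and the negative part moved across,
    to become one between natural numbers.\<close>
  define S where "S z j \<longleftrightarrow> a (prod_encode (z, Suc j)) * 2 ^ j
      \<le> d (prod_encode (z, Suc j)) + 1 + b (prod_encode (z, Suc j)) * 2 ^ j" for z j
  have S_iff: "S z j \<longleftrightarrow> (real (a (prod_encode (z, Suc j))) - real (b (prod_encode (z, Suc j))))
      / real (d (prod_encode (z, Suc j)) + 1) \<le> 1 / 2 ^ j" for z j
  proof -
    have "S z j \<longleftrightarrow> real (a (prod_encode (z, Suc j)) * 2 ^ j)
      \<le> real (d (prod_encode (z, Suc j)) + 1 + b (prod_encode (z, Suc j)) * 2 ^ j)"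
      unfolding S_def of_nat_le_iff ..
    then show ?thesis by (simp add: field_simps)
  qed
  show ?thesis
  proof (rule that)
    show "decidable (\<lambda>z. S (pr1 z) (pr2 z))" unfolding S_def
      by (intro comp_intros abd[THEN computable_fun_comp])
    have half: "(1::real) / 2 ^ j = 1 / 2 ^ Suc j + 1 / 2 ^ Suc j" for j :: nat
      by (simp add: field_simps)
    show "S (str_code \<sigma>) j" if "?\<mu> \<sigma> \<le> 1 / 2 ^ Suc j" for \<sigma> j
      unfolding S_iff using approx[of \<sigma> "Suc j"] that half[of j] by (simp only: abs_le_iff) linarith
    have pos: "(0::real) < 1 / 2 ^ Suc j" for j :: nat by simp
    have two: "(2::real) / 2 ^ j = 1 / 2 ^ j + 1 / 2 ^ j" for j :: nat by simp
    show "?\<mu> \<sigma> < 2 / 2 ^ j" if "S (str_code \<sigma>) j" for \<sigma> j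
      using approx[of \<sigma> "Suc j"] that[unfolded S_iff] half[of j] two[of j] pos[of j]
      by (simp only: abs_le_iff) linarith
  qed
qed

text \<open>Fix j with 2 / 2^j below the mass of Y, and N such that the length-N cylinder around Y
  has less than 2^-(j+1) of mass besides Y. All initial segments of Y fail the test S at j, while
  every other string extending the one of length N passes it, so Y can be found by search.\<close>

lemma atom_computable:
  assumes \<mu>: "computable_measure \<mu>" and Y: "measure \<mu> {Y} \<noteq> 0"
  shows "computable_seq Y"
proof -
  interpret prob_space \<mu> by (rule cantor_measure_prob[OF \<mu>])
  let ?\<mu> = "\<lambda>\<sigma>. measure \<mu> (cylinder \<sigma>)"
  obtain S where S: "decidable (\<lambda>z. S (pr1 z) (pr2 z))"
    "\<And>\<sigma> j. ?\<mu> \<sigma> \<le> 1 / 2 ^ Suc j \<Longrightarrow> S (str_code \<sigma>) j"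
    "\<And>\<sigma> j. S (str_code \<sigma>) j \<Longrightarrow> ?\<mu> \<sigma> < 2 / 2 ^ j"
    by (rule computable_measure_threshold[OF \<mu>]) blast
  have pos: "measure \<mu> {Y} > 0" using Y by (simp add: zero_less_measure_iff)
  have "(\<lambda>j. 2 * (1 / 2) ^ j :: real) \<longlonglongrightarrow> 2 * 0"
    by (intro tendsto_intros LIMSEQ_power_zero) simp
  then have "\<forall>\<^sub>F j in sequentially. 2 * (1 / 2) ^ j < measure \<mu> {Y}"
    using pos by (intro order_tendstoD(2)) auto
  then obtain j where j: "2 / 2 ^ j < measure \<mu> {Y}"
    by (auto simp: eventually_sequentially power_one_over)
  have "\<forall>\<^sub>F n in sequentially. ?\<mu> (init_seg Y n) < measure \<mu> {Y} + 1 / 2 ^ Suc j"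
    using measure_singleton_limit[OF \<mu>, of Y] by (rule order_tendstoD(2)) simp
  then obtain N where N: "?\<mu> (init_seg Y N) < measure \<mu> {Y} + 1 / 2 ^ Suc j"
    by (auto simp: eventually_sequentially)
  have yes: "\<not> S (str_code (init_seg Y n)) j" for n
    using S(3)[of "init_seg Y n" j] j measure_singleton_le[OF \<mu>, of Y n] by linarith
  have no: "S (str_code \<tau>) j" if \<tau>: "length \<tau> \<ge> N" "take N \<tau> = init_seg Y N" "\<tau> \<noteq> init_seg Y (length \<tau>)" for \<tau>
  proof (rule S(2))
    have "(\<Inter>n. cylinder (init_seg Y n)) \<in> sets \<mu>"
      using cylinder_in_sets[OF \<mu>] by (intro sets.countable_INT) auto
    then have Y_sets: "{Y} \<in> sets \<mu>" by (simp add: Inter_cylinder_init_seg)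
    have disj: "cylinder \<tau> \<inter> {Y} = {}" using \<tau>(3) by (auto simp: mem_cylinder_iff)
    have "?\<mu> \<tau> + measure \<mu> {Y} = measure \<mu> (cylinder \<tau> \<union> {Y})"
      by (rule finite_measure_Union[symmetric, OF cylinder_in_sets[OF \<mu>] Y_sets disj])
    also have "\<dots> \<le> ?\<mu> (init_seg Y N)"
    proof (rule finite_measure_mono[OF _ cylinder_in_sets[OF \<mu>]])
      show "cylinder \<tau> \<union> {Y} \<subseteq> cylinder (init_seg Y N)"
        using cylinder_take_subset[of \<tau> N] by (auto simp: \<tau>(2) mem_cylinder_iff)
    qed
    finally show "?\<mu> \<tau> \<le> 1 / 2 ^ Suc j" using N by linarith
  qed
  \<comment> \<open>The length N + n + 1 is at least N, as the uniqueness argument demands, and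
    large enough for bit n to be present.\<close>
  let ?P = "\<lambda>n z. is_string z \<and> length_code z = N + Suc n \<and> take_code N z = str_code (init_seg Y N) \<and> \<not> S z j"
  have P_iff: "?P n z \<longleftrightarrow> z = str_code (init_seg Y (N + Suc n))" for n z
  proof
    assume z: "?P n z"
    then obtain \<tau> where "z = str_code \<tau>" by (auto simp: is_string_iff)
    with z no[of \<tau>] show "z = str_code (init_seg Y (N + Suc n))" by auto
  qed (use yes in \<open>auto simp: take_init_seg\<close>)
  define h where "h n = (LEAST z. ?P n z)" for n
  have "computable_fun h" unfolding h_def
    by (intro comp_intros decidable_comp2[OF S(1)]) (subst P_iff, blast)
  then have "computable_fun (\<lambda>n. of_bool (nth_code (h n) n = 1))"
    by (intro comp_intros)
  moreover have "h n = str_code (init_seg Y (N + Suc n))" for n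
    unfolding h_def P_iff by (rule Least_equality) auto
  then have "of_bool (nth_code (h n) n = 1) = (of_bool (Y n) :: nat)" for n
    by simp
  ultimately show ?thesis unfolding computable_seq_def by simp
qed

text \<open>Koenig's lemma for the tree of strings of measure greater than \<open>\<epsilon>\<close>.\<close>

lemma continuous_measure_uniformly_small:
  assumes \<mu>: "computable_measure \<mu>" "continuous_measure \<mu>" and "\<epsilon> > 0"
  shows "\<exists>n. \<forall>\<sigma>. length \<sigma> = n \<longrightarrow> measure \<mu> (cylinder \<sigma>) \<le> \<epsilon>"
proof (rule ccontr)
  assume "\<not> ?thesis"
  then have ex: "\<exists>\<sigma>. length \<sigma> = n \<and> measure \<mu> (cylinder \<sigma>) > \<epsilon>" for n
    by (auto simp: not_le)
  define big where "big \<sigma> \<longleftrightarrow> (\<forall>n\<ge>length \<sigma>. \<exists>\<tau>. length \<tau> = n \<and> take (length \<sigma>) \<tau> = \<sigma> \<and>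
    measure \<mu> (cylinder \<tau>) > \<epsilon>)" for \<sigma>
  have "big []" using ex by (auto simp: big_def)
  have step: "\<exists>b. big (\<sigma> @ [b])" if \<sigma>: "big \<sigma>" for \<sigma>
  proof (rule ccontr)
    let ?l = "Suc (length \<sigma>)"
    assume "\<nexists>b. big (\<sigma> @ [b])"
    then have "\<forall>b. \<exists>n\<ge>?l. \<forall>\<tau>. length \<tau> = n \<longrightarrow> take ?l \<tau> = \<sigma> @ [b] \<longrightarrow> \<not> measure \<mu> (cylinder \<tau>) > \<epsilon>"
      unfolding big_def by simp blast
    then obtain f where f: "\<And>b. f b \<ge> ?l"
      "\<And>b \<tau>. length \<tau> = f b \<Longrightarrow> take ?l \<tau> = \<sigma> @ [b] \<Longrightarrow> \<not> measure \<mu> (cylinder \<tau>) > \<epsilon>"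
      by metis
    \<comment> \<open>If neither one-bit extension were \<open>big\<close>, both would have died out
      by this level, since truncating a string does not decrease the measure of its
      cylinder.\<close>
    let ?n = "max (f True) (f False)"
    have "?n \<ge> length \<sigma>" using f(1)[of True] by simp
    then obtain \<tau> where \<tau>: "length \<tau> = ?n" "take (length \<sigma>) \<tau> = \<sigma>" "measure \<mu> (cylinder \<tau>) > \<epsilon>"
      using \<sigma> unfolding big_def by blast
    define b where "b = \<tau> ! length \<sigma>"
    have "f b \<le> ?n" by (cases b) auto
    have "length \<sigma> < length \<tau>" using f(1)[of True] \<tau>(1) by simp
    then have "take ?l \<tau> = \<sigma> @ [b]" by (simp add: take_Suc_conv_app_nth \<tau>(2) b_def)
    then have "take ?l (take (f b) \<tau>) = \<sigma> @ [b]" using f(1)[of b] by (simp add: min_absorb1)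
    moreover have "length (take (f b) \<tau>) = f b" using \<open>f b \<le> ?n\<close> \<tau>(1) by simp
    ultimately have "\<not> measure \<mu> (cylinder (take (f b) \<tau>)) > \<epsilon>" by (intro f(2))
    with \<tau>(3) measure_cylinder_take_le[OF \<mu>(1), of \<tau> "f b"] show False by linarith
  qed
  have "\<exists>s. \<forall>n. (big (s n) \<and> length (s n) = n) \<and> (\<exists>b. s (Suc n) = s n @ [b])"
  proof (rule dependent_nat_choice)
    show "\<exists>\<sigma>. big \<sigma> \<and> length \<sigma> = 0" using \<open>big []\<close> by auto
    show "\<exists>\<sigma>'. (big \<sigma>' \<and> length \<sigma>' = Suc n) \<and> (\<exists>b. \<sigma>' = \<sigma> @ [b])"
      if "big \<sigma> \<and> length \<sigma> = n" for \<sigma> n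
      using step[of \<sigma>] that by auto
  qed
  then obtain s where s: "\<And>n. big (s n)" "\<And>n. length (s n) = n" "\<And>n. \<exists>b. s (Suc n) = s n @ [b]"
    by blast
  define Y where "Y n = s (Suc n) ! n" for n
  have Y: "init_seg Y n = s n" for n
  proof (induction n)
    case 0
    then show ?case using s(2)[of 0] by (simp add: init_seg_def)
  next
    case (Suc n)
    obtain b where "s (Suc n) = s n @ [b]" using s(3) by blast
    with Suc s(2)[of n] show ?case by (simp add: init_seg_def Y_def nth_append)
  qed
  have "\<epsilon> \<le> measure \<mu> (cylinder (init_seg Y n))" for n
    using s(1)[of n] s(2)[of n] unfolding big_def Y by fastforce
  then have "\<epsilon> \<le> measure \<mu> {Y}"
    by (intro LIMSEQ_le_const[OF measure_singleton_limit[OF \<mu>(1)]]) auto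
  then show False using \<open>\<epsilon> > 0\<close> \<mu>(2) by (simp add: continuous_measure_def)
qed

lemma continuous_measure_modulus:
  assumes \<mu>: "computable_measure \<mu>" "continuous_measure \<mu>"
  obtains g where "computable_fun g"
    "\<And>e \<sigma>. g e \<le> length \<sigma> \<Longrightarrow> measure \<mu> (cylinder \<sigma>) \<le> 1 / 2 ^ e"
proof -
  let ?\<mu> = "\<lambda>\<sigma>. measure \<mu> (cylinder \<sigma>)"
  obtain S where S: "decidable (\<lambda>z. S (pr1 z) (pr2 z))"
    "\<And>\<sigma> j. ?\<mu> \<sigma> \<le> 1 / 2 ^ Suc j \<Longrightarrow> S (str_code \<sigma>) j"
    "\<And>\<sigma> j. S (str_code \<sigma>) j \<Longrightarrow> ?\<mu> \<sigma> < 2 / 2 ^ j"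
    by (rule computable_measure_threshold[OF \<mu>(1)]) blast
  \<comment> \<open>Passing S at e + 1 certifies measure below 2 / 2^(e+1) = 2^-e. Some n passes,
    because all cylinders are eventually of measure at most 2^-(e+2).\<close>
  define T where "T e n \<longleftrightarrow>
    (\<forall>z<Suc (string_bound n). is_string z \<and> length_code z = n \<longrightarrow> S z (Suc e))" for e n
  have T_iff: "T e n \<longleftrightarrow> (\<forall>\<sigma>. length \<sigma> = n \<longrightarrow> S (str_code \<sigma>) (Suc e))" for e n
    unfolding T_def by (auto simp: is_string_iff less_Suc_eq_le str_code_le_string_bound)
  have ex: "\<exists>n. T e n" for e
  proof -
    obtain n where "\<And>\<sigma>. length \<sigma> = n \<Longrightarrow> ?\<mu> \<sigma> \<le> 1 / 2 ^ Suc (Suc e)"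
      using continuous_measure_uniformly_small[OF \<mu>, of "1 / 2 ^ Suc (Suc e)"] by auto
    then show ?thesis unfolding T_iff using S(2) by blast
  qed
  define g where "g e = (LEAST n. T e n)" for e
  show ?thesis
  proof (rule that)
    have "decidable (\<lambda>z. T (pr1 z) (pr2 z))" unfolding T_def
      by (intro comp_intros decidable_comp2[OF S(1)])
    then show "computable_fun g" unfolding g_def by (rule computable_fun_Least) (rule ex)
    fix e and \<sigma> :: "bool list" assume len: "g e \<le> length \<sigma>"
    have "T e (g e)" unfolding g_def by (rule LeastI_ex) (rule ex)
    then have "S (str_code (take (g e) \<sigma>)) (Suc e)" using len by (simp add: T_iff)
    then have "?\<mu> (take (g e) \<sigma>) < 2 / 2 ^ Suc e" by (rule S(3))
    with measure_cylinder_take_le[OF \<mu>(1), of \<sigma> "g e"] show "?\<mu> \<sigma> \<le> 1 / 2 ^ e"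
      by simp
  qed
qed

section \<open>Consequences of randomness for a continuous measure\<close>

text \<open>The common core of the two tests: h proposes at most one cylinder for each level i and
  each z. The exponent z + i + 1 makes the measures at level i add up to at most 2^-i, so X escapes
  all proposals of some level.\<close>

lemma random_avoids_cylinders:
  assumes \<mu>: "computable_measure \<mu>" and X: "martin_loef_random \<mu> X"
    and h: "partial_computable h"
    and small: "\<And>i z \<sigma>. h (prod_encode (i, z)) = Some (str_code \<sigma>) \<Longrightarrow>
      measure \<mu> (cylinder \<sigma>) \<le> 1 / 2 ^ (z + i + 1)"
  shows "\<exists>i. \<forall>z \<sigma>. h (prod_encode (i, z)) = Some (str_code \<sigma>) \<longrightarrow> X \<notin> cylinder \<sigma>"
proof -
  interpret prob_space \<mu> by (rule cantor_measure_prob[OF \<mu>])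
  define C where "C i z = \<Union>{cylinder \<sigma> |\<sigma>. h (prod_encode (i, z)) = Some (str_code \<sigma>)}" for i z
  define V where "V i = (\<Union>z. C i z)" for i
  have C: "C i z \<in> sets \<mu>" "measure \<mu> (C i z) \<le> 1 / 2 ^ (z + i + 1)" for i z
  proof -
    have *: "C i z = {} \<or> (\<exists>\<sigma>. h (prod_encode (i, z)) = Some (str_code \<sigma>) \<and> C i z = cylinder \<sigma>)"
    proof (cases "\<exists>\<sigma>. h (prod_encode (i, z)) = Some (str_code \<sigma>)")
      case True
      then obtain \<sigma> where "h (prod_encode (i, z)) = Some (str_code \<sigma>)" by blast
      then show ?thesis unfolding C_def by auto
    qed (auto simp: C_def)
    then show "C i z \<in> sets \<mu>" using cylinder_in_sets[OF \<mu>] by auto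
    show "measure \<mu> (C i z) \<le> 1 / 2 ^ (z + i + 1)" using * small by (auto simp del: power_Suc)
  qed
  have "martin_loef_test \<mu> V"
    unfolding martin_loef_test_def
  proof (intro conjI allI)
    have "semidecidable (\<lambda>x. \<exists>z. h (prod_encode (pr1 x, z)) = Some (pr2 x))"
      by (intro semidecidable_ex semidecidable_graph h comp_intros)
    then have "ce_set {x. \<exists>z. h (prod_encode (pr1 x, z)) = Some (pr2 x)}"
      by (simp add: ce_set_Collect_iff)
    then show "uniformly_sigma1 V"
      unfolding uniformly_sigma1_def V_def C_def
      by (rule_tac exI, rule_tac conjI, assumption) auto
  next
    fix i
    have half: "(\<lambda>z. (1 / 2 ^ (i + 1)) * (1 / 2) ^ z) sums ((1 / 2 ^ (i + 1)) * (1 / (1 - 1 / 2)) :: real)"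
      by (intro sums_mult geometric_sums) simp
    have eq: "(1 / 2 ^ (i + 1)) * (1 / 2) ^ z = (1 / 2 ^ (z + i + 1) :: real)" for z
      by (simp add: power_add power_one_over field_simps)
    have sums: "(\<lambda>z. 1 / 2 ^ (z + i + 1) :: real) sums (1 / 2 ^ i)"
      using half unfolding eq by simp
    have sm: "summable (\<lambda>z. measure \<mu> (C i z))"
      by (rule summable_comparison_test'[OF sums_summable[OF sums], of 0]) (use C(2) in simp)
    have "measure \<mu> (V i) \<le> (\<Sum>z. measure \<mu> (C i z))"
      unfolding V_def using C(1) by (intro finite_measure_subadditive_countably sm) auto
    also have "\<dots> \<le> (\<Sum>z. 1 / 2 ^ (z + i + 1))"
      by (intro suminf_le C(2) sm sums_summable[OF sums])
    also have "\<dots> = 1 / 2 ^ i" using sums by (simp add: sums_iff)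
    finally show "measure \<mu> (V i) \<le> 1 / 2 ^ i" .
  qed
  with X obtain i where "X \<notin> V i" unfolding martin_loef_random_def by blast
  then show ?thesis unfolding V_def C_def by blast
qed

lemma continuous_random_imp_hyperavoidable:
  assumes \<mu>: "computable_measure \<mu>" "continuous_measure \<mu>" "martin_loef_random \<mu> X"
  shows "hyperavoidable X"
proof -
  obtain g where g: "computable_fun g"
    "\<And>e \<sigma>. g e \<le> length \<sigma> \<Longrightarrow> measure \<mu> (cylinder \<sigma>) \<le> 1 / 2 ^ e"
    by (rule continuous_measure_modulus[OF \<mu>(1,2)]) blast
  define R where "R x y \<longleftrightarrow> length_code y = g (pr2 x + pr1 x + 1) \<and>
    (\<forall>m<length_code y. evals (pr2 x) m (nth_code y m))" for x y
  have "semidecidable (\<lambda>z. R (pr1 z) (pr2 z))" unfolding R_def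
    by (intro semidecidable_conj semidecidable_all_less semidecidable_evals comp_intros)
      (intro decidable_imp_semidecidable comp_intros computable_fun_comp[OF g(1)])
  then obtain h where h: "partial_computable h" "\<And>x y. h x = Some y \<Longrightarrow> R x y"
      "\<And>x y. R x y \<Longrightarrow> h x \<noteq> None"
    by (rule semidecidable_uniformization) blast
  have small: "measure \<mu> (cylinder \<sigma>) \<le> 1 / 2 ^ (z + i + 1)"
    if "h (prod_encode (i, z)) = Some (str_code \<sigma>)" for i z \<sigma>
    using h(2)[OF that] by (intro g(2)) (simp add: R_def)
  obtain i where i: "\<And>z \<sigma>. h (prod_encode (i, z)) = Some (str_code \<sigma>) \<Longrightarrow> X \<notin> cylinder \<sigma>"
    using random_avoids_cylinders[OF \<mu>(1,3) h(1) small] by blast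
  show ?thesis
  proof (rule hyperavoidableI)
    show "computable_fun (\<lambda>e. g (e + i + 1))" by (intro comp_intros computable_fun_comp[OF g(1)])
    fix M e assume e: "index_of e M"
    have ev: "evals e m (of_bool (M m))" for m
      using e by (intro phi_imp_evals) (simp add: index_of_def)
    let ?\<sigma> = "init_seg M (g (e + i + 1))"
    have "R (prod_encode (i, e)) (str_code ?\<sigma>)" unfolding R_def using ev by simp
    then obtain y where y: "h (prod_encode (i, e)) = Some y" using h(3) by blast
    have "y = str_code ?\<sigma>"
    proof (rule code_eqI)
      show "length_code y = length_code (str_code ?\<sigma>)" using h(2)[OF y] by (simp add: R_def)
      fix m assume m: "m < length_code y"
      then have "evals e m (nth_code y m)" using h(2)[OF y] by (simp add: R_def)
      from evals_unique[OF this ev] show "nth_code y m = nth_code (str_code ?\<sigma>) m"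
        using m h(2)[OF y] by (simp add: R_def)
    qed
    with i y have "X \<notin> cylinder ?\<sigma>" by blast
    then show "init_seg X (g (e + i + 1)) \<noteq> ?\<sigma>" by (simp add: mem_cylinder_iff)
  qed
qed

lemma continuous_random_imp_complex:
  assumes U: "universal_prefix_free_machine U"
    and \<mu>: "computable_measure \<mu>" "continuous_measure \<mu>" "martin_loef_random \<mu> X"
  shows "complex_seq U X"
proof -
  obtain g where g: "computable_fun g"
    "\<And>e \<sigma>. g e \<le> length \<sigma> \<Longrightarrow> measure \<mu> (cylinder \<sigma>) \<le> 1 / 2 ^ e"
    by (rule continuous_measure_modulus[OF \<mu>(1,2)]) blast
  obtain p where p: "\<And>\<tau>. run p (str_code \<tau>) = map_option str_code (U \<tau>)"
    using U unfolding universal_prefix_free_machine_def prefix_free_machine_def by blast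
  \<comment> \<open>Here x is <i, z>, with z the code of a description. Its output is tested only if
    it is long compared with z, which makes its cylinder small enough.\<close>
  define R where "R x y \<longleftrightarrow> evals (goedel p) (pr2 x) y \<and> g (pr2 x + pr1 x + 1) \<le> length_code y" for x y
  have "semidecidable (\<lambda>z. R (pr1 z) (pr2 z))" unfolding R_def
    by (intro semidecidable_conj semidecidable_evals comp_intros)
      (intro decidable_imp_semidecidable comp_intros computable_fun_comp[OF g(1)])
  then obtain h where h: "partial_computable h" "\<And>x y. h x = Some y \<Longrightarrow> R x y"
      "\<And>x y. R x y \<Longrightarrow> h x \<noteq> None"
    by (rule semidecidable_uniformization) blast
  have small: "measure \<mu> (cylinder \<sigma>) \<le> 1 / 2 ^ (z + i + 1)"
    if "h (prod_encode (i, z)) = Some (str_code \<sigma>)" for i z \<sigma>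
    using h(2)[OF that] by (intro g(2)) (simp add: R_def)
  obtain i where i: "\<And>z \<sigma>. h (prod_encode (i, z)) = Some (str_code \<sigma>) \<Longrightarrow> X \<notin> cylinder \<sigma>"
    using random_avoids_cylinders[OF \<mu>(1,3) h(1) small] by blast
  \<comment> \<open>A description of a longer segment of X would put that segment into level i,
    which X avoids.\<close>
  have less: "n < g (str_code \<tau> + i + 1)" if \<tau>: "U \<tau> = Some (init_seg X n)" for \<tau> n
  proof (rule ccontr)
    assume "\<not> n < g (str_code \<tau> + i + 1)"
    then have "R (prod_encode (i, str_code \<tau>)) (str_code (init_seg X n))"
      unfolding R_def by (simp add: evals_goedel_iff p \<tau>)
    then obtain y where y: "h (prod_encode (i, str_code \<tau>)) = Some y" using h(3) by blast
    then have "y = str_code (init_seg X n)"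
      using h(2)[OF y] unfolding R_def by (simp add: evals_goedel_iff p \<tau>)
    with i y have "X \<notin> cylinder (init_seg X n)" by blast
    then show False by (simp add: mem_cylinder_iff)
  qed
  \<comment> \<open>The sum dominates the bound for every description of length m, all of whose
    codes are at most \<open>string_bound m\<close>. The summand \<open>Suc m\<close> makes G
    unbounded, so that f is total, and G 0 positive, so that f 0 = 0.\<close>
  define G where "G m = Suc m + (\<Sum>z<Suc (string_bound m). g (z + i + 1))" for m
  have "computable_fun G" unfolding G_def
    by (intro comp_intros computable_fun_comp[OF g(1)])
  have G_ge: "g (str_code \<tau> + i + 1) \<le> G (length \<tau>)" for \<tau>
    using member_le_sum[of "str_code \<tau>" "{..<Suc (string_bound (length \<tau>))}" "\<lambda>z. g (z + i + 1)"]
      str_code_le_string_bound[of \<tau>] by (simp add: G_def less_Suc_eq_le)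
  define f where "f n = (LEAST m. n < G m)" for n
  have ex: "\<exists>m. n < G m" for n by (rule exI[of _ n]) (simp add: G_def)
  have f: "n < G (f n)" for n unfolding f_def by (rule LeastI_ex) (rule ex)
  have f_le: "f n \<le> m" if "n < G m" for n m unfolding f_def by (rule Least_le) (rule that)
  have "computable_fun f" unfolding f_def
    by (intro comp_intros computable_fun_comp[OF \<open>computable_fun G\<close>] ex)
  moreover have "order_fun f" unfolding order_fun_def
  proof (intro conjI allI)
    show "mono f" by (intro monoI f_le) (meson f le_less_trans)
    have "f 0 \<le> 0" by (rule f_le) (simp add: G_def)
    then show "f 0 = 0" by simp
    fix b
    \<comment> \<open>Otherwise G at this value of f would be one of the summands, hence at most the
      sum that it has to exceed.\<close>
    have "b < f (\<Sum>m\<le>b. G m)"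
    proof (rule ccontr)
      assume "\<not> b < f (\<Sum>m\<le>b. G m)"
      then have "G (f (\<Sum>m\<le>b. G m)) \<le> (\<Sum>m\<le>b. G m)" by (intro member_le_sum) auto
      with f[of "\<Sum>m\<le>b. G m"] show False by simp
    qed
    then show "\<exists>n. b < f n" ..
  qed
  moreover have "f n \<le> K U (init_seg X n)" for n
  proof -
    obtain \<tau> where \<tau>: "U \<tau> = Some (init_seg X n)" "length \<tau> = K U (init_seg X n)"
      by (rule K_witness[OF U]) blast
    have "n < G (length \<tau>)" using less[OF \<tau>(1)] G_ge[of \<tau>] by simp
    then show ?thesis using f_le \<tau>(2) by simp
  qed
  ultimately show ?thesis unfolding complex_seq_def by blast
qed

section \<open>Removing the atoms of a computable measure\<close>

text \<open>Lets measurability into Cantor space be checked coordinate by coordinate, through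
  \<open>measurable_coordinatewise_then_product\<close>.\<close>

instance bool :: second_countable_topology
proof
  have "open = generate_topology (UNIV :: bool set set)"
    by (simp add: fun_eq_iff Topological_Spaces.open_discrete generate_topology.Basis)
  then show "\<exists>B :: bool set set. countable B \<and> open = generate_topology B"
    by (intro exI[of _ UNIV]) simp
qed

section \<open>Fair coin flips\<close>

definition coin_measure :: "cantor measure" where
  "coin_measure = PiM UNIV (\<lambda>_. measure_pmf (bernoulli_pmf (1 / 2)))"

lemma prob_space_coin_measure: "prob_space coin_measure"
proof -
  interpret product_prob_space "\<lambda>_::nat. measure_pmf (bernoulli_pmf (1 / 2))" UNIV
    by unfold_locales
  show ?thesis unfolding coin_measure_def by (rule prob_space_axioms)
qed

lemma space_coin_measure [simp]: "space coin_measure = UNIV"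
  by (simp add: coin_measure_def space_PiM)

lemma coin_measure_agree:
  assumes "finite J"
  shows "{Z. \<forall>m\<in>J. Z m = z m} \<in> sets coin_measure"
    "measure coin_measure {Z. \<forall>m\<in>J. Z m = z m} = (1 / 2) ^ card J"
proof -
  interpret product_prob_space "\<lambda>_::nat. measure_pmf (bernoulli_pmf (1 / 2))" UNIV
    by unfold_locales
  have eq: "{Z. \<forall>m\<in>J. Z m = z m} = emb UNIV J (Pi\<^sub>E J (\<lambda>m. {z m}))"
    by (simp add: prod_emb_def PiE_UNIV_domain vimage_def restrict_PiE_iff Pi_def Ball_def)
  show "{Z. \<forall>m\<in>J. Z m = z m} \<in> sets coin_measure"
    unfolding eq coin_measure_def by (rule sets_PiM_I) (simp_all add: assms)
  show "measure coin_measure {Z. \<forall>m\<in>J. Z m = z m} = (1 / 2) ^ card J"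
    unfolding eq coin_measure_def using measure_PiM_emb[OF subset_UNIV assms, of "\<lambda>m. {z m}"]
    by (simp add: measure_pmf_single)
qed

lemma open_init_seg: "open {Y. P (init_seg Y n)}"
proof -
  have "{Y. P (init_seg Y n)} = (\<Union>\<sigma>\<in>{\<sigma>. length \<sigma> = n \<and> P \<sigma>}. cylinder \<sigma>)"
    by (auto simp: mem_cylinder_iff)
  then show ?thesis by (auto intro: open_cylinder)
qed

text \<open>The dead strings stand for those seen to enter V. Decidability serves the computability
  of \<nu>; closure under extension ensures that coin flipping, once begun, never stops.\<close>

locale redistribution =
  fixes \<mu> :: "cantor measure" and dead :: "nat \<Rightarrow> bool"
  assumes computable_\<mu>: "computable_measure \<mu>"
    and decidable_dead: "decidable dead"
    and dead_mono: "dead (str_code (take k \<sigma>)) \<Longrightarrow> dead (str_code \<sigma>)"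
begin

sublocale M: prob_space \<mu>
  by (rule cantor_measure_prob[OF computable_\<mu>])

sublocale C: prob_space coin_measure
  by (rule prob_space_coin_measure)

sublocale MC: pair_prob_space \<mu> coin_measure ..

lemma space_\<mu>: "space \<mu> = UNIV"
  using sets_eq_imp_space_eq[OF cantor_measure_sets[OF computable_\<mu>]] by simp

text \<open>Whether to flip at m is decided by the original Y, not by the output. The two agree up
  to the shortest dead prefix of Y, so a cylinder can be analysed from the output alone.\<close>

definition replace :: "cantor \<times> cantor \<Rightarrow> cantor" where
  "replace = (\<lambda>(Y, Z) m. if dead (str_code (init_seg Y m)) then Z m else Y m)"

definition \<nu> :: "cantor measure" where
  "\<nu> = distr (\<mu> \<Otimes>\<^sub>M coin_measure) borel replace"

lemma measurable_replace: "replace \<in> borel_measurable (\<mu> \<Otimes>\<^sub>M coin_measure)"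
proof -
  have "(\<lambda>w. replace w m) \<in> borel_measurable (\<mu> \<Otimes>\<^sub>M coin_measure)" for m
  proof -
  have 1: "Measurable.pred \<mu> (\<lambda>Y. dead (str_code (init_seg Y m)))"
    using open_in_sets[OF computable_\<mu> open_init_seg] by (simp add: pred_def space_\<mu>)
  have "{Y. Y m} = {Y. init_seg Y (Suc m) ! m}" by simp
  then have 2: "Measurable.pred \<mu> (\<lambda>Y. Y m)"
    using open_in_sets[OF computable_\<mu> open_init_seg[of "\<lambda>\<sigma>. \<sigma> ! m" "Suc m"]]
    by (simp add: pred_def space_\<mu>)
  have 3: "Measurable.pred coin_measure (\<lambda>Z. Z m)"
    using coin_measure_agree(1)[of "{m}" "\<lambda>_. True"] by (simp add: pred_def)
  have "Measurable.pred (\<mu> \<Otimes>\<^sub>M coin_measure)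
      (\<lambda>w. if dead (str_code (init_seg (fst w) m)) then snd w m else fst w m)"
    by (intro measurable_If measurable_compose[OF measurable_fst 1, unfolded pred_def]
        measurable_compose[OF measurable_fst 2] measurable_compose[OF measurable_snd 3])
  then have "(\<lambda>w. replace w m) \<in> measurable (\<mu> \<Otimes>\<^sub>M coin_measure) (count_space UNIV)"
    by (simp add: replace_def case_prod_beta)
  then show "(\<lambda>w. replace w m) \<in> borel_measurable (\<mu> \<Otimes>\<^sub>M coin_measure)"
    by (subst measurable_cong_sets[OF refl sets_borel_eq_count_space])
  qed
  then show ?thesis by (rule measurable_coordinatewise_then_product)
qed

lemma cantor_measure_\<nu>: "cantor_measure \<nu>"
  unfolding cantor_measure_def \<nu>_def
  by (simp add: MC.prob_space_distr[OF measurable_replace])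

sublocale N: prob_space \<nu>
  using cantor_measure_\<nu> by (simp add: cantor_measure_def)

text \<open>The length of the shortest dead prefix. The first alternative makes it the full length
  when no prefix is dead, and guarantees that the search ends.\<close>

definition live_length :: "nat \<Rightarrow> nat" where
  "live_length z = (LEAST k. k = length_code z \<or> dead (take_code k z))"

lemma live_length_le: "live_length (str_code \<sigma>) \<le> length \<sigma>"
  unfolding live_length_def by (rule Least_le) simp

lemma dead_live_length:
  "live_length (str_code \<sigma>) < length \<sigma> \<Longrightarrow> dead (str_code (take (live_length (str_code \<sigma>)) \<sigma>))"
proof -
  have "live_length (str_code \<sigma>) = length_code (str_code \<sigma>) \<or>
      dead (take_code (live_length (str_code \<sigma>)) (str_code \<sigma>))"
    unfolding live_length_def by (rule LeastI) (rule disjI1, rule refl)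
  then show "live_length (str_code \<sigma>) < length \<sigma> \<Longrightarrow> ?thesis" by simp
qed

lemma not_dead_less_live_length:
  "k < live_length (str_code \<sigma>) \<Longrightarrow> \<not> dead (str_code (take k \<sigma>))"
  using not_less_Least[of k "\<lambda>k. k = length_code (str_code \<sigma>) \<or> dead (take_code k (str_code \<sigma>))"]
  unfolding live_length_def[symmetric] by simp

lemma computable_fun_live_length [comp_intros]:
  assumes "computable_fun f"
  shows "computable_fun (\<lambda>x. live_length (f x))"
  unfolding live_length_def
  by (intro comp_intros computable_fun_comp[OF assms] decidable_comp[OF decidable_dead])
    (rule exI, rule disjI1, rule refl)

text \<open>Shows that the preimage of a cylinder is a rectangle: Y fixes the first k bits and Z the
  others. The product measure of a rectangle then gives the formula for \<nu>.\<close>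

lemma replace_in_cylinder_iff:
  fixes \<tau> :: "bool list"
  defines "k \<equiv> live_length (str_code \<tau>)"
  shows "replace (Y, Z) \<in> cylinder \<tau> \<longleftrightarrow>
    Y \<in> cylinder (take k \<tau>) \<and> (\<forall>m\<in>{k..<length \<tau>}. Z m = \<tau> ! m)"
proof -
  have k: "k \<le> length \<tau>" unfolding k_def by (rule live_length_le)
  have live: "replace (Y, Z) m = Y m" if "m < k" "init_seg Y m = take m \<tau>" for m
    using not_dead_less_live_length[of m \<tau>] that by (simp add: replace_def k_def)
  have dead: "replace (Y, Z) m = Z m"
    if Y: "Y \<in> cylinder (take k \<tau>)" and m: "m \<in> {k..<length \<tau>}" for m
  proof -
    have "init_seg Y k = take k \<tau>" using Y k by (simp add: mem_cylinder_iff)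
    then have "dead (str_code (init_seg Y k))" using dead_live_length[of \<tau>] m by (simp add: k_def)
    moreover have "take k (init_seg Y m) = init_seg Y k"
      using m by (simp add: take_init_seg min_absorb1)
    ultimately have "dead (str_code (init_seg Y m))" using dead_mono by metis
    then show ?thesis by (simp add: replace_def)
  qed
  show ?thesis
  proof
    assume r: "replace (Y, Z) \<in> cylinder \<tau>"
    \<comment> \<open>That bit m is copied from Y is known only once Y agrees with \<tau> below m;
      hence strong induction.\<close>
    have Y: "m < k \<Longrightarrow> Y m = \<tau> ! m" for m
    proof (induction m rule: less_induct)
      case (less m)
      then have "init_seg Y m = take m \<tau>" using k by (auto simp: list_eq_iff_nth_eq)
      from live[OF less.prems this] show ?case using r less.prems k by (simp add: mem_cylinder_nth)
    qed
    then have "Y \<in> cylinder (take k \<tau>)" by (simp add: mem_cylinder_nth)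
    with dead r show "Y \<in> cylinder (take k \<tau>) \<and> (\<forall>m\<in>{k..<length \<tau>}. Z m = \<tau> ! m)"
      by (auto simp: mem_cylinder_nth[of _ \<tau>])
  next
    assume YZ: "Y \<in> cylinder (take k \<tau>) \<and> (\<forall>m\<in>{k..<length \<tau>}. Z m = \<tau> ! m)"
    have "replace (Y, Z) m = \<tau> ! m" if "m < length \<tau>" for m
    proof (cases "m < k")
      case True
      then have "init_seg Y m = take m \<tau>" using YZ k by (auto simp: list_eq_iff_nth_eq mem_cylinder_nth)
      from live[OF True this] show ?thesis using YZ True k by (simp add: mem_cylinder_nth)
    next
      case False
      then show ?thesis using dead[of m] YZ that by simp
    qed
    then show "replace (Y, Z) \<in> cylinder \<tau>" by (simp add: mem_cylinder_nth)
  qed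
qed

lemma measure_\<nu>:
  assumes "A \<in> sets borel"
  shows "measure \<nu> A = measure (\<mu> \<Otimes>\<^sub>M coin_measure) (replace -` A)"
  unfolding \<nu>_def using assms
  by (subst measure_distr[OF measurable_replace]) (auto simp: space_pair_measure space_\<mu>)

lemma measure_Times:
  assumes "A \<in> sets \<mu>" "B \<in> sets coin_measure"
  shows "measure (\<mu> \<Otimes>\<^sub>M coin_measure) (A \<times> B) = measure \<mu> A * measure coin_measure B"
  using assms by (simp add: measure_def C.emeasure_pair_measure_Times enn2real_mult)

lemma measure_\<nu>_cylinder:
  "measure \<nu> (cylinder \<tau>) = measure \<mu> (cylinder (take (live_length (str_code \<tau>)) \<tau>))
      * (1 / 2) ^ (length \<tau> - live_length (str_code \<tau>))"
proof -
  let ?k = "live_length (str_code \<tau>)"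
  have "measure \<nu> (cylinder \<tau>) = measure (\<mu> \<Otimes>\<^sub>M coin_measure) (replace -` cylinder \<tau>)"
    by (rule measure_\<nu>) (simp add: open_cylinder)
  also have "replace -` cylinder \<tau> =
      cylinder (take ?k \<tau>) \<times> {Z. \<forall>m\<in>{?k..<length \<tau>}. Z m = \<tau> ! m}"
    by (auto simp: replace_in_cylinder_iff)
  also have "measure (\<mu> \<Otimes>\<^sub>M coin_measure) \<dots> = measure \<mu> (cylinder (take ?k \<tau>)) *
      measure coin_measure {Z. \<forall>m\<in>{?k..<length \<tau>}. Z m = \<tau> ! m}"
    by (intro measure_Times cylinder_in_sets[OF computable_\<mu>] coin_measure_agree(1)) simp
  also have "measure coin_measure {Z. \<forall>m\<in>{?k..<length \<tau>}. Z m = \<tau> ! m} = (1 / 2) ^ (length \<tau> - ?k)"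
    by (subst coin_measure_agree(2)) auto
  finally show ?thesis .
qed

section \<open>Computability, continuity and randomness for the redistributed measure\<close>

lemma computable_measure_\<nu>: "computable_measure \<nu>"
  unfolding computable_measure_def
proof
  let ?\<mu> = "\<lambda>\<sigma>. measure \<mu> (cylinder \<sigma>)"
  obtain a b d where abd: "computable_fun a" "computable_fun b" "computable_fun d"
    and approx: "\<And>\<sigma> n. \<bar>?\<mu> \<sigma> - (real (a (prod_encode (str_code \<sigma>, n))) - real (b (prod_encode (str_code \<sigma>, n))))
      / real (d (prod_encode (str_code \<sigma>, n)) + 1)\<bar> \<le> 1 / 2 ^ n"
    using computable_\<mu> unfolding computable_measure_def computable_real_fun_def Let_def by blast
  define t where "t x = prod_encode (take_code (live_length (pr1 x)) (pr1 x), pr2 x)" for x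
  define l where "l x = length_code (pr1 x) - live_length (pr1 x)" for x
  have comp: "computable_fun t" "computable_fun l"
    unfolding t_def l_def by (intro comp_intros)+
  \<comment> \<open>The factor 2^-l is absorbed into the denominator, which is stored minus one.
    Precision n at the truncated string suffices, since the factor is at most 1.\<close>
  let ?d = "\<lambda>x. (d (t x) + 1) * 2 ^ l x - 1"
  have "\<bar>measure \<nu> (cylinder \<sigma>) - (real (a (t x)) - real (b (t x))) / real (?d x + 1)\<bar> \<le> 1 / 2 ^ n"
    if x: "x = prod_encode (str_code \<sigma>, n)" for \<sigma> n x
  proof -
    let ?k = "live_length (str_code \<sigma>)"
    define q where "q = (real (a (t x)) - real (b (t x))) / real (d (t x) + 1)"
    have tx: "t x = prod_encode (str_code (take ?k \<sigma>), n)" and lx: "l x = length \<sigma> - ?k"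
      by (simp_all add: t_def l_def x)
    have "?d x + 1 = (d (t x) + 1) * 2 ^ l x" by simp
    then have "real (?d x + 1) = real (d (t x) + 1) * 2 ^ l x" by (metis of_nat_mult of_nat_numeral of_nat_power)
    then have 1: "(real (a (t x)) - real (b (t x))) / real (?d x + 1) = q * (1 / 2) ^ l x"
      by (simp add: q_def power_one_over)
    have "\<bar>measure \<nu> (cylinder \<sigma>) - q * (1 / 2) ^ l x\<bar> = \<bar>?\<mu> (take ?k \<sigma>) - q\<bar> * (1 / 2) ^ l x"
      unfolding measure_\<nu>_cylinder lx left_diff_distrib[symmetric] abs_mult by simp
    also have "\<dots> \<le> 1 / 2 ^ n * 1"
    proof (rule mult_mono)
      show "\<bar>?\<mu> (take ?k \<sigma>) - q\<bar> \<le> 1 / 2 ^ n"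
        using approx[of "take ?k \<sigma>" n] unfolding q_def tx .
    qed (auto intro: power_le_one)
    finally show ?thesis unfolding 1 by simp
  qed
  moreover have "computable_fun (\<lambda>x. a (t x))" "computable_fun (\<lambda>x. b (t x))" "computable_fun ?d"
    by (intro comp_intros comp computable_fun_comp[OF abd(1)] computable_fun_comp[OF abd(2)]
        computable_fun_comp[OF abd(3)])+
  ultimately show "computable_real_fun (\<lambda>\<sigma>. measure \<nu> (cylinder \<sigma>))"
    unfolding computable_real_fun_def Let_def by blast
qed (rule cantor_measure_\<nu>)

lemma live_length_init_seg_dead:
  assumes "dead (str_code (init_seg Y k))" "k \<le> n"
  shows "live_length (str_code (init_seg Y n)) \<le> k"
  unfolding live_length_def using assms
  by (intro Least_le) (simp add: take_init_seg min_absorb1)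

lemma live_length_init_seg_live:
  assumes "\<And>k. \<not> dead (str_code (init_seg Y k))"
  shows "live_length (str_code (init_seg Y n)) = n"
proof (rule antisym)
  show "live_length (str_code (init_seg Y n)) \<le> n"
    using live_length_le[of "init_seg Y n"] by simp
  show "n \<le> live_length (str_code (init_seg Y n))"
    using dead_live_length[of "init_seg Y n"] assms
    by (cases "live_length (str_code (init_seg Y n)) < n") (simp_all add: take_init_seg)
qed

text \<open>Behind a dead prefix of Y each further bit costs a factor 1/2. Without dead prefixes
  \<nu> and \<mu> agree on all initial segments of Y, hence on the singleton by passing to the
  limit.\<close>

lemma continuous_measure_\<nu>:
  assumes live: "\<And>Y. \<forall>k. \<not> dead (str_code (init_seg Y k)) \<Longrightarrow> measure \<mu> {Y} = 0"
  shows "continuous_measure \<nu>"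
  unfolding continuous_measure_def
proof
  fix Y
  note lim = measure_singleton_limit[OF computable_measure_\<nu>, of Y]
  show "measure \<nu> {Y} = 0"
  proof (cases "\<exists>k. dead (str_code (init_seg Y k))")
    case True
    then obtain k where k: "dead (str_code (init_seg Y k))" by blast
    have "measure \<nu> (cylinder (init_seg Y n)) \<le> (1 / 2) ^ (n - k)" if "n \<ge> k" for n
    proof -
      let ?l = "live_length (str_code (init_seg Y n))"
      have "measure \<nu> (cylinder (init_seg Y n)) \<le> 1 * (1 / 2) ^ (n - ?l)"
        unfolding measure_\<nu>_cylinder by (simp add: M.prob_le_1)
      also have "\<dots> \<le> (1 / 2) ^ (n - k)"
        using live_length_init_seg_dead[OF k that] by (simp add: power_decreasing)
      finally show ?thesis .
    qed
    then have "\<forall>\<^sub>F n in sequentially. measure \<nu> (cylinder (init_seg Y n)) \<le> (1 / 2) ^ (n - k)"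
      by (auto simp: eventually_sequentially)
    moreover have "(\<lambda>n. (1 / 2) ^ (n - k) :: real) \<longlonglongrightarrow> 0"
      by (rule LIMSEQ_offset[of _ k]) (simp add: LIMSEQ_power_zero)
    ultimately have "measure \<nu> {Y} \<le> 0"
      using lim by (intro tendsto_le[of sequentially _ 0]) auto
    then show ?thesis by (simp add: measure_le_0_iff)
  next
    case False
    then have "measure \<nu> (cylinder (init_seg Y n)) = measure \<mu> (cylinder (init_seg Y n))" for n
      using live_length_init_seg_live[of Y n] by (simp add: measure_\<nu>_cylinder)
    with lim have "(\<lambda>n. measure \<mu> (cylinder (init_seg Y n))) \<longlonglongrightarrow> measure \<nu> {Y}" by simp
    with measure_singleton_limit[OF computable_\<mu>, of Y] have "measure \<nu> {Y} = measure \<mu> {Y}"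
      using LIMSEQ_unique by blast
    with live False show ?thesis by simp
  qed
qed

text \<open>Discarding dead strings turns a test for \<nu> into one for \<mu>, and X loses nothing
  by it, as its own initial segments are never dead.\<close>

lemma random_\<nu>:
  assumes X: "martin_loef_random \<mu> X" and live: "\<And>k. \<not> dead (str_code (init_seg X k))"
  shows "martin_loef_random \<nu> X"
  unfolding martin_loef_random_def
proof (intro allI impI)
  fix V assume V: "martin_loef_test \<nu> V"
  then obtain W where W: "ce_set W" "\<And>i. V i = \<Union>{cylinder \<sigma> |\<sigma>. prod_encode (i, str_code \<sigma>) \<in> W}"
    unfolding martin_loef_test_def uniformly_sigma1_def by blast
  define W' where "W' = {x. x \<in> W \<and> \<not> dead (pr2 x)}"
  define V' where "V' i = \<Union>{cylinder \<sigma> |\<sigma>. prod_encode (i, str_code \<sigma>) \<in> W'}" for i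
  have "semidecidable (\<lambda>x. x \<in> W \<and> \<not> dead (pr2 x))"
    by (intro semidecidable_conj W(1)[unfolded ce_set_iff] decidable_imp_semidecidable
        decidable_not decidable_comp[OF decidable_dead] comp_intros)
  then have "ce_set W'" unfolding W'_def ce_set_Collect_iff .
  then have "uniformly_sigma1 V'" unfolding uniformly_sigma1_def V'_def by blast
  moreover have "measure \<mu> (V' i) \<le> 1 / 2 ^ i" for i
  proof -
    have "open (V i)" "open (V' i)" unfolding V'_def W(2) by (auto intro: open_cylinder)
    \<comment> \<open>The comparison is between sets in the product and not string by string,
      because the cylinders of a test may overlap.\<close>
    have sub: "V' i \<times> UNIV \<subseteq> replace -` V i"
    proof clarify
      fix Y Z assume "Y \<in> V' i"
      then obtain \<sigma> where \<sigma>: "Y \<in> cylinder \<sigma>" "prod_encode (i, str_code \<sigma>) \<in> W" "\<not> dead (str_code \<sigma>)"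
        unfolding V'_def W'_def by auto
      have "live_length (str_code \<sigma>) = length \<sigma>"
        using dead_live_length[of \<sigma>] live_length_le[of \<sigma>] dead_mono \<sigma>(3) by (meson le_neq_implies_less)
      with \<sigma>(1) have "replace (Y, Z) \<in> cylinder \<sigma>" by (simp add: replace_in_cylinder_iff)
      with \<sigma>(2) show "(Y, Z) \<in> replace -` V i" unfolding W(2) by blast
    qed
    have "measure \<mu> (V' i) = measure (\<mu> \<Otimes>\<^sub>M coin_measure) (V' i \<times> UNIV)"
      using measure_Times[OF open_in_sets[OF computable_\<mu> \<open>open (V' i)\<close>], of UNIV]
        C.prob_space sets.top[of coin_measure] by simp
    also have "\<dots> \<le> measure (\<mu> \<Otimes>\<^sub>M coin_measure) (replace -` V i)"
    proof (rule MC.finite_measure_mono[OF sub])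
      show "replace -` V i \<in> sets (\<mu> \<Otimes>\<^sub>M coin_measure)"
        using measurable_sets[OF measurable_replace borel_open[OF \<open>open (V i)\<close>]]
        by (simp add: space_pair_measure space_\<mu>)
    qed
    also have "\<dots> = measure \<nu> (V i)" using \<open>open (V i)\<close> by (simp add: measure_\<nu>)
    also have "\<dots> \<le> 1 / 2 ^ i" using V by (simp add: martin_loef_test_def)
    finally show ?thesis .
  qed
  ultimately obtain i where i: "X \<notin> V' i"
    using X unfolding martin_loef_random_def martin_loef_test_def by blast
  have "X \<notin> V i"
  proof
    assume "X \<in> V i"
    then obtain \<sigma> where \<sigma>: "X \<in> cylinder \<sigma>" "prod_encode (i, str_code \<sigma>) \<in> W"
      unfolding W(2) by blast
    moreover have "\<not> dead (str_code \<sigma>)"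
      using live[of "length \<sigma>"] \<sigma>(1) by (simp add: mem_cylinder_iff)
    ultimately show False using i unfolding V'_def W'_def by auto
  qed
  then show "X \<notin> (\<Inter>i. V i)" by blast
qed

end

lemma separated_random_imp_continuous_random:
  assumes \<mu>: "computable_measure \<mu>" "martin_loef_random \<mu> X"
    and V: "sigma1_class V" "X \<notin> V" "\<And>Y. computable_seq Y \<Longrightarrow> Y \<in> V"
  shows "X \<notin> NCR_comp"
proof -
  obtain W where W: "ce_set W" "V = \<Union>{cylinder \<sigma> |\<sigma>. str_code \<sigma> \<in> W}"
    using V(1) unfolding sigma1_class_def by blast
  obtain Q where Q: "decidable (\<lambda>z. Q (pr1 z) (pr2 z))" "\<And>x. x \<in> W \<longleftrightarrow> (\<exists>s. Q x s)"
    using W(1) unfolding ce_set_iff by (rule semidecidableE) blast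
  \<comment> \<open>Prefix and enumeration stage are both bounded by the length of z. A sequence
    that enters V through \<sigma> at stage s has a dead prefix by length |\<sigma>| + s.\<close>
  define dead where "dead z \<longleftrightarrow> (\<exists>k<Suc (length_code z). \<exists>s<Suc (length_code z). Q (take_code k z) s)" for z
  interpret redistribution \<mu> dead
  proof
    show "decidable dead" unfolding dead_def by (intro comp_intros decidable_comp2[OF Q(1)])
    fix k \<sigma> assume "dead (str_code (take k \<sigma>))"
    then obtain j s where js: "j \<le> length \<sigma>" "j \<le> k" "s \<le> length \<sigma>" "Q (str_code (take j (take k \<sigma>))) s"
      unfolding dead_def by (auto simp: less_Suc_eq_le)
    then show "dead (str_code \<sigma>)" unfolding dead_def
      by (intro exI[of _ j] exI[of _ s] conjI) (simp_all add: less_Suc_eq_le min_absorb1)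
  qed (rule \<mu>(1))
  have dead_iff: "(\<exists>k. dead (str_code (init_seg Y k))) \<longleftrightarrow> Y \<in> V" for Y
  proof
    assume "\<exists>k. dead (str_code (init_seg Y k))"
    then obtain k j s where "Q (str_code (take j (init_seg Y k))) s" unfolding dead_def by auto
    then have "str_code (init_seg Y (min j k)) \<in> W" using Q(2) by (auto simp: take_init_seg)
    moreover have "Y \<in> cylinder (init_seg Y (min j k))" by (simp add: mem_cylinder_iff)
    ultimately show "Y \<in> V" unfolding W(2) by blast
  next
    assume "Y \<in> V"
    then obtain \<sigma> where \<sigma>: "Y \<in> cylinder \<sigma>" "str_code \<sigma> \<in> W" unfolding W(2) by blast
    then obtain s where "Q (str_code \<sigma>) s" using Q(2) by blast
    then have "dead (str_code (init_seg Y (length \<sigma> + s)))"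
      unfolding dead_def using \<sigma>(1)
      by (intro exI[of _ "length \<sigma>"] exI[of _ s] conjI) (simp_all add: take_init_seg mem_cylinder_iff)
    then show "\<exists>k. dead (str_code (init_seg Y k))" by blast
  qed
  have "continuous_measure \<nu>"
  proof (rule continuous_measure_\<nu>)
    fix Y assume "\<forall>k. \<not> dead (str_code (init_seg Y k))"
    then have "Y \<notin> V" using dead_iff by blast
    then show "measure \<mu> {Y} = 0" using V(3) atom_computable[OF \<mu>(1)] by blast
  qed
  moreover have "martin_loef_random \<nu> X"
    using V(2) dead_iff by (intro random_\<nu> \<mu>(2)) blast
  ultimately show ?thesis using computable_measure_\<nu> unfolding NCR_comp_def by blast
qed

section \<open>The cycle of implications\<close>

lemma not_NCR_compE:
  assumes "X \<notin> NCR_comp"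
  obtains \<mu> where "computable_measure \<mu>" "continuous_measure \<mu>" "martin_loef_random \<mu> X"
  using assms unfolding NCR_comp_def by blast

lemma avoidable_imp_not_semigeneric: "avoidable X \<Longrightarrow> \<not> semigeneric X"
  by (metis avoidable_imp_noncomputable avoidable_imp_separating_sigma1_class not_semigeneric_iff)

lemma not_semigeneric_imp_not_NCR_comp:
  assumes "proper X" "\<not> computable_seq X" "\<not> semigeneric X"
  shows "X \<notin> NCR_comp"
  using assms separated_random_imp_continuous_random
  unfolding not_semigeneric_iff[OF assms(2)] proper_def by blast

lemma not_NCR_comp_imp_hyperavoidable: "X \<notin> NCR_comp \<Longrightarrow> hyperavoidable X"
  by (metis not_NCR_compE continuous_random_imp_hyperavoidable)

theorem corollary3p15:
  fixes X :: cantor and U :: "bool list \<Rightarrow> bool list option"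
  shows "(universal_prefix_free_machine U \<and> proper X \<and> \<not> computable_seq X \<longrightarrow>
            (complex_seq U X \<longleftrightarrow> X \<notin> NCR_comp) \<and>
            (complex_seq U X \<longleftrightarrow> \<not> semigeneric X) \<and>
            (complex_seq U X \<longleftrightarrow> avoidable X) \<and>
            (complex_seq U X \<longleftrightarrow> hyperavoidable X)) \<and>
         \<not> (\<exists>Y. conditionally_avoidable Y \<and> proper Y)"
proof (intro conjI impI)
  assume "universal_prefix_free_machine U \<and> proper X \<and> \<not> computable_seq X"
  then have U: "universal_prefix_free_machine U" and X: "proper X" "\<not> computable_seq X" by auto
  have "complex_seq U X \<Longrightarrow> hyperavoidable X"
    by (rule complex_imp_hyperavoidable[OF U _ X(2)])
  moreover have "X \<notin> NCR_comp \<Longrightarrow> complex_seq U X"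
    by (metis not_NCR_compE continuous_random_imp_complex[OF U])
  moreover note hyperavoidable_imp_avoidable[of X] avoidable_imp_not_semigeneric[of X]
    not_semigeneric_imp_not_NCR_comp[OF X]
  ultimately show "complex_seq U X \<longleftrightarrow> X \<notin> NCR_comp" "complex_seq U X \<longleftrightarrow> \<not> semigeneric X"
    "complex_seq U X \<longleftrightarrow> avoidable X" "complex_seq U X \<longleftrightarrow> hyperavoidable X"
    by blast+
next
  show "\<not> (\<exists>Y. conditionally_avoidable Y \<and> proper Y)"
    \<comment> \<open>With no universal machine at hand, the argument takes the arc from avoidable
      through a separating class and a continuous measure to hyperavoidable. Avoidability itself
      supplies that Y is not computable.\<close>
    unfolding conditionally_avoidable_def
    using avoidable_imp_noncomputable avoidable_imp_not_semigeneric
      not_semigeneric_imp_not_NCR_comp not_NCR_comp_imp_hyperavoidable by blast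
qed

end
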